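(* Let $m=x_{i_1}\cdots x_{i_s}$ be a square-free monomial in $S=\mathbb{K}[x_1,\ldots,x_n]$ (with $s\ge 1$ and $i_1<\cdots<i_s\le n$), with $T(m) = (t_0,t_1,\ldots,t_k)$ and $IT(m) = (i_{t_0},i_{t_1},\ldots,i_{t_k})$, and let $I = {\rm sfBorel}(m)$. Let $\ell\in\{0,\ldots,k\}$ be the smallest integer such that $i_{t_{\ell+1}} < t_0 \leq i_{t_\ell}$ (where the condition $i_{t_{\ell+1}}<t_0$ is vacuous if $\ell=k$). Then $$\widehat{\alpha}(I) \;\leq\; \frac{t_0 -t_{\ell}}{i_{t_\ell}-t_\ell+1} \;+\; \sum_{j=\ell}^{k-1}\frac{i_{t_j}-i_{t_{j+1}}}{i_{t_j}-t_j+1} \;+\; \frac{i_{t_k}}{i_{t_k}-t_k+1}.$$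
   Context: $\mathbb{K}$ is a field of characteristic zero and $S=\mathbb{K}[x_1,\ldots,x_n]$. Borel moves: for a monomial $m$, if $x_i \mid m$ and $j<i$, then $x_j\cdot\frac{m}{x_i}$ is called a Borel move of $m$. For a square-free monomial $m\in S$, ${\rm sfBorel}(m)\subseteq S$ is the square-free monomial ideal generated by all square-free monomials that can be obtained from $m$ by a (possibly empty) sequence of Borel moves. The tuples $T(m)$, $IT(m)$: for $m=x_{i_1}\cdots x_{i_s}$ with $i_1<\cdots<i_s$, put $t_0=s$ and, recursively, $t_p=\max\{j<t_{p-1} \mid i_j<i_{j+1}-1\}$ as long as this set is non-empty; $T(m)=(t_0,t_1,\ldots,t_k)$ is the resulting tuple, where $t_k$ is the last term defined. Then $IT(m)=(i_{t_0},i_{t_1},\ldots,i_{t_k})$. One has $t_0>\cdots>t_k\geq 1$ and $i_{t_0}>\cdots>i_{t_k}$; since $t_0=s\le i_s=i_{t_0}$, the integer $\ell$ exists. Waldschmidt constant: for a square-free monomial ideal $I$ with minimal primary decomposition $I=P_1\cap\cdots\cap P_r$, the $q$-th symbolic power is $I^{(q)}=P_1^q\cap\cdots\cap P_r^q$. For a homogeneous ideal $J$, $\alpha(J)$ denotes the smallest degree of a generator of $J$. The Waldschmidt constant of $I$ is $\widehat{\alpha}(I)=\lim_{q\to\infty}\alpha(I^{(q)})/q$. *)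

theory Defs
  imports Complex_Main "HOL-Library.Poly_Mapping" "HOL-Algebra.Ideal_Product"
begin

text \<open>
  A monomial \<open>x\<^sub>1^a\<^sub>1 \<cdots> x\<^sub>n^a\<^sub>n\<close> is encoded by its exponent vector \<open>nat \<Rightarrow>\<^sub>0 nat\<close> (so products of
  monomials are sums of exponent vectors), and a polynomial by its finitely supported family of
  coefficients; multiplication on \<open>(nat \<Rightarrow>\<^sub>0 nat) \<Rightarrow>\<^sub>0 'k\<close> is convolution.
\<close>

type_synonym monom = "nat \<Rightarrow>\<^sub>0 nat"
type_synonym 'k mpoly = "monom \<Rightarrow>\<^sub>0 'k"

definition poly_ring :: "nat \<Rightarrow> ('k::field_char_0) mpoly ring"
  where "poly_ring n =
    \<lparr>carrier = {p. \<forall>u \<in> Poly_Mapping.keys p. Poly_Mapping.keys u \<subseteq> {1..n}},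
     mult = (*), one = 1, zero = 0, add = (+)\<rparr>"

lemma carrier_poly_ring:
  "p \<in> carrier (poly_ring n) \<longleftrightarrow> (\<forall>u \<in> Poly_Mapping.keys p. Poly_Mapping.keys u \<subseteq> {1..n})"
  by (simp only: poly_ring_def partial_object.simps mem_Collect_eq)

lemma poly_ring_uminus_closed:
  "- p \<in> carrier (poly_ring n)" if "p \<in> carrier (poly_ring n)"
  using that unfolding carrier_poly_ring by simp

lemma poly_ring_plus_closed:
  "p + q \<in> carrier (poly_ring n)" if "p \<in> carrier (poly_ring n)" "q \<in> carrier (poly_ring n)"
  using that Poly_Mapping.keys_add[of p q] unfolding carrier_poly_ring by blast

lemma poly_ring_times_closed:
  "p * q \<in> carrier (poly_ring n)" if pq: "p \<in> carrier (poly_ring n)" "q \<in> carrier (poly_ring n)"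
  unfolding carrier_poly_ring
proof
  fix u
  assume "u \<in> Poly_Mapping.keys (p * q)"
  then obtain a b where "u = a + b" "a \<in> Poly_Mapping.keys p" "b \<in> Poly_Mapping.keys q"
    using Poly_Mapping.keys_mult[of p q] by blast
  then show "Poly_Mapping.keys u \<subseteq> {1..n}"
    using pq Poly_Mapping.keys_add[of a b] unfolding carrier_poly_ring by blast
qed

lemma cring_poly_ring: "cring (poly_ring n :: ('k::field_char_0) mpoly ring)"
proof (rule cringI)
  show "abelian_group (poly_ring n :: 'k mpoly ring)"
  proof (rule abelian_groupI)
    fix p q :: "'k mpoly"
    assume "p \<in> carrier (poly_ring n)" "q \<in> carrier (poly_ring n)"
    then show "p \<oplus>\<^bsub>poly_ring n\<^esub> q \<in> carrier (poly_ring n)"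
      using poly_ring_plus_closed[of p n q] by (simp add: poly_ring_def)
  next
    fix p :: "'k mpoly"
    assume "p \<in> carrier (poly_ring n)"
    then show "\<exists>q \<in> carrier (poly_ring n). q \<oplus>\<^bsub>poly_ring n\<^esub> p = \<zero>\<^bsub>poly_ring n\<^esub>"
      by (intro bexI[of _ "- p"] poly_ring_uminus_closed) (simp_all add: poly_ring_def)
  qed (simp_all add: poly_ring_def add.assoc add.commute)
  show "comm_monoid (poly_ring n :: 'k mpoly ring)"
  proof (rule comm_monoidI)
    fix p q :: "'k mpoly"
    assume "p \<in> carrier (poly_ring n)" "q \<in> carrier (poly_ring n)"
    then show "p \<otimes>\<^bsub>poly_ring n\<^esub> q \<in> carrier (poly_ring n)"
      using poly_ring_times_closed[of p n q] by (simp add: poly_ring_def)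
  qed (simp_all add: poly_ring_def mult.assoc mult.commute)
qed (simp add: poly_ring_def distrib_right)


text \<open>\<open>borel_move u v\<close>: \<open>v = x\<^sub>j \<cdot> (u / x\<^sub>i)\<close> where \<open>x\<^sub>i\<close> divides \<open>u\<close> and \<open>j < i\<close>; variables start at \<open>x\<^sub>1\<close>.\<close>

definition borel_move :: "monom \<Rightarrow> monom \<Rightarrow> bool"
  where "borel_move u v \<longleftrightarrow>
    (\<exists>i \<in> Poly_Mapping.keys u. \<exists>j \<ge> 1. j < i \<and>
      v = u - Poly_Mapping.single i 1 + Poly_Mapping.single j 1)"

definition squarefree_monom :: "monom \<Rightarrow> bool"
  where "squarefree_monom u \<longleftrightarrow> (\<forall>i. Poly_Mapping.lookup u i \<le> 1)"

text \<open>The intermediate monomials of a sequence of Borel moves need not be square-free.\<close>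

definition sfBorel :: "nat \<Rightarrow> monom \<Rightarrow> ('k::field_char_0) mpoly set"
  where "sfBorel n m =
    genideal (poly_ring n)
      {Poly_Mapping.single u 1 | u. borel_move\<^sup>*\<^sup>* m u \<and> squarefree_monom u}"


text \<open>
  \<open>T_tuple i s\<close> is the tuple \<open>T(m) = (t\<^sub>0, \<dots>, t\<^sub>k)\<close> of \<open>m = x\<^bsub>i 1\<^esub> \<cdots> x\<^bsub>i s\<^esub>\<close>; the recursion is on the
  current entry of the tuple, starting from \<open>t\<^sub>0 = s\<close>.
\<close>

function T_tuple :: "(nat \<Rightarrow> nat) \<Rightarrow> nat \<Rightarrow> nat list"
  where "T_tuple i t =
    (let J = {j. 1 \<le> j \<and> j < t \<and> i j < i (j + 1) - 1}
     in t # (if J = {} then [] else T_tuple i (Max J)))"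
  by pat_completeness auto
termination
proof (relation "measure snd")
  fix i :: "nat \<Rightarrow> nat" and t :: nat and J
  assume J: "J = {j. 1 \<le> j \<and> j < t \<and> i j < i (j + 1) - 1}" and "J \<noteq> {}"
  have "finite J"
    unfolding J by (rule finite_subset[of _ "{..<t}"]) auto
  then have "Max J \<in> J"
    using \<open>J \<noteq> {}\<close> by (rule Max_in)
  moreover have "j < t" if "j \<in> J" for j
    using that by (simp add: J)
  ultimately show "((i, Max J), (i, t)) \<in> measure snd"
    by simp
qed simp

declare T_tuple.simps [simp del]


definition radical_ideal :: "('a, 'b) ring_scheme \<Rightarrow> 'a set \<Rightarrow> 'a set"
  where "radical_ideal R Q = {a \<in> carrier R. \<exists>e::nat. e > 0 \<and> a [^]\<^bsub>R\<^esub> e \<in> Q}"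

definition primary_ideal :: "('a, 'b) ring_scheme \<Rightarrow> 'a set \<Rightarrow> bool"
  where "primary_ideal R Q \<longleftrightarrow>
    ideal Q R \<and> Q \<noteq> carrier R \<and>
    (\<forall>a \<in> carrier R. \<forall>b \<in> carrier R. a \<otimes>\<^bsub>R\<^esub> b \<in> Q \<longrightarrow> a \<in> Q \<or> b \<in> radical_ideal R Q)"

text \<open>
  Minimal means: no component is redundant and the radicals of the components are distinct.
  Intersecting with the carrier makes the empty intersection the unit ideal.
\<close>

definition minimal_primary_decomposition ::
    "('a, 'b) ring_scheme \<Rightarrow> 'a set \<Rightarrow> 'a set set \<Rightarrow> bool"
  where "minimal_primary_decomposition R I D \<longleftrightarrow>
    finite D \<and> (\<forall>Q \<in> D. primary_ideal R Q) \<and>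
    carrier R \<inter> \<Inter> D = I \<and>
    inj_on (radical_ideal R) D \<and>
    (\<forall>Q \<in> D. carrier R \<inter> \<Inter> (D - {Q}) \<noteq> I)"

text \<open>
  Only meant for ideals whose minimal primary decomposition is unique. This covers the square-free
  monomial ideals: they are radical, so the components are exactly the minimal primes.
\<close>

definition symbolic_power :: "('a, 'b) ring_scheme \<Rightarrow> 'a set \<Rightarrow> nat \<Rightarrow> 'a set"
  where "symbolic_power R I q =
    carrier R \<inter> (\<Inter>P \<in> (THE D. minimal_primary_decomposition R I D). P [^]\<^bsub>ideals_set R\<^esub> q)"


definition monom_degree :: "monom \<Rightarrow> nat"
  where "monom_degree u = (\<Sum>i \<in> Poly_Mapping.keys u. Poly_Mapping.lookup u i)"

definition homogeneous_of_degree :: "nat \<Rightarrow> ('k::zero) mpoly \<Rightarrow> bool"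
  where "homogeneous_of_degree d p \<longleftrightarrow> p \<noteq> 0 \<and> (\<forall>u \<in> Poly_Mapping.keys p. monom_degree u = d)"

text \<open>
  The smallest degree of a generator of a nonzero homogeneous ideal \<open>J\<close>, over all generating sets
  consisting of nonzero homogeneous polynomials. Each such generating set, in particular each
  minimal one, attains this smallest degree.
\<close>

definition homogeneous_generating_set ::
    "nat \<Rightarrow> ('k::field_char_0) mpoly set \<Rightarrow> 'k mpoly set \<Rightarrow> bool"
  where "homogeneous_generating_set n J G \<longleftrightarrow>
    G \<subseteq> carrier (poly_ring n) \<and> (\<forall>g \<in> G. \<exists>d. homogeneous_of_degree d g) \<and>
    genideal (poly_ring n) G = J"

definition alpha :: "nat \<Rightarrow> ('k::field_char_0) mpoly set \<Rightarrow> nat"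
  where "alpha n J =
    (LEAST d. \<exists>G. homogeneous_generating_set n J G \<and> (\<exists>g \<in> G. homogeneous_of_degree d g))"

definition waldschmidt :: "nat \<Rightarrow> ('k::field_char_0) mpoly set \<Rightarrow> real"
  where "waldschmidt n I =
    lim (\<lambda>q. real (alpha n (symbolic_power (poly_ring n) I q)) / real q)"

end

theory Submission
  imports Defs
begin

text \<open>
  The Waldschmidt constant is bounded from above by exhibiting monomials of small degree in the
  symbolic powers. A square-free monomial ideal is the intersection of the primes
  \<open>P\<^sub>A\<close> generated by the variables \<open>x\<^sub>h\<close> with \<open>h \<in> A\<close>, where \<open>A\<close> runs through the minimal sets meeting
  the supports of all generators (minimal transversals); this is its only minimal primary
  decomposition (\<open>minimal_primary_decomposition_primes\<close>). Hence a monomial lies in the \<open>q\<close>-th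
  symbolic power iff, for every transversal \<open>A\<close>, its exponents at \<open>A\<close> add up to at least \<open>q\<close>
  (\<open>symbolic_power_squarefree\<close>). If real weights \<open>y\<^sub>h \<ge> 0\<close> add up to at least 1 over every transversal,
  rounding up \<open>q y\<^sub>h\<close> gives such a monomial, of degree at most \<open>q \<Sum>\<^sub>h y\<^sub>h + n\<close>. The least degrees are
  subadditive in \<open>q\<close>, so the limit exists by Fekete's lemma and is at most \<open>\<Sum>\<^sub>h y\<^sub>h\<close>
  (\<open>waldschmidt_squarefree_le\<close>).

  It remains to find weights for \<open>sfBorel\<close> with the stated sum. A transversal \<open>A\<close> must
  contain at least \<open>i j - j + 1\<close> elements of \<open>{1..i j}\<close> for some \<open>j\<close>, since otherwise enough elements are
  left over to choose, for every \<open>j\<close>, a variable of index at most \<open>i j\<close> outside \<open>A\<close>, all of them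
  distinct (\<open>transversal_borel_supports_large\<close>). The number \<open>i j - j + 1\<close> is constant on the blocks
  of consecutive indices whose right ends make up the tuple \<open>T(m)\<close>; on the block with right end
  \<open>t p\<close> call it \<open>d p\<close>. So weights of at least \<open>1 / d p\<close> on \<open>{1..i (t p)}\<close> for every \<open>p\<close> would suffice.
  The weights used here (\<open>block_weights\<close>) do this for \<open>p \<ge> l\<close>, and for \<open>p < l\<close> they replace the
  long segment of small weights by \<open>t 0 - t l\<close> further weights \<open>1 / d l\<close> just beyond \<open>i (t l)\<close>. That
  is enough: at most \<open>j - 1 < t 0\<close> elements of \<open>{1..i j}\<close> are missing from \<open>A\<close>, so at least \<open>d l\<close>
  elements of \<open>A\<close> carry a weight of at least \<open>1 / d l\<close>.
\<close>

section \<open>Minimal primary decompositions of finite intersections of primes\<close>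

text \<open>
  Prime avoidance in its multiplicative form: the product of elements chosen outside \<open>X\<close>, one from
  each ideal, lies in all the ideals and outside \<open>X\<close>. It serves both prime ideals \<open>X\<close> and radicals
  \<open>X\<close> of primary ideals, so only the multiplicative closure of the complement is assumed.
\<close>

lemma (in cring) ex_in_all_ideals_notin:
  assumes "finite D" "\<And>K. K \<in> D \<Longrightarrow> ideal K R" "\<And>K. K \<in> D \<Longrightarrow> \<not> K \<subseteq> X"
    and "\<one> \<notin> X"
    and mult: "\<And>a b. a \<in> carrier R \<Longrightarrow> b \<in> carrier R \<Longrightarrow> a \<notin> X \<Longrightarrow> b \<notin> X \<Longrightarrow> a \<otimes> b \<notin> X"
  shows "\<exists>b \<in> carrier R. b \<notin> X \<and> (\<forall>K \<in> D. b \<in> K)"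
  using assms(1-3)
proof (induction D rule: finite_induct)
  case empty
  then show ?case using \<open>\<one> \<notin> X\<close> by auto
next
  case (insert L D)
  then obtain b where b: "b \<in> carrier R" "b \<notin> X" "\<forall>K \<in> D. b \<in> K" by auto
  obtain a where a: "a \<in> L" "a \<notin> X" using insert.prems(2)[of L] by auto
  interpret L: ideal L R using insert.prems(1) by simp
  have ac: "a \<in> carrier R" using a L.Icarr by simp
  have "a \<otimes> b \<in> K" if "K \<in> insert L D" for K
  proof (cases "K = L")
    case True
    then show ?thesis using L.I_r_closed[OF a(1) b(1)] by simp
  next
    case False
    then have "K \<in> D" using that by simp
    then show ?thesis using ideal.I_l_closed[of K R b a] insert.prems(1) that b ac by simp
  qed
  then show ?case using mult[OF ac b(1) a(2) b(2)] ac b(1) by (intro bexI[of _ "a \<otimes> b"]) auto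
qed

lemma (in cring) primeideal_nat_pow:
  assumes "primeideal P R" "a \<in> carrier R" "a [^] (e::nat) \<in> P"
  shows "a \<in> P"
proof -
  interpret P: primeideal P R by fact
  show ?thesis
    using assms(3)
  proof (induction e)
    case 0
    then show ?case using P.one_imp_carrier P.I_notcarr by simp
  next
    case (Suc e)
    then show ?case using P.I_prime[of "a [^] e" a] assms(2) by auto
  qed
qed

lemma (in cring) radical_ideal_primeideal:
  assumes "primeideal P R"
  shows "radical_ideal R P = P"
proof -
  interpret P: primeideal P R by fact
  have "a \<in> radical_ideal R P" if "a \<in> P" for a
    unfolding radical_ideal_def using that P.Icarr by (auto intro!: exI[of _ "1::nat"])
  then show ?thesis
    using primeideal_nat_pow[OF assms] unfolding radical_ideal_def by blast
qed

lemma (in cring) primary_ideal_primeideal: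
  assumes "primeideal P R"
  shows "primary_ideal R P"
proof -
  interpret P: primeideal P R by fact
  show ?thesis
    unfolding primary_ideal_def radical_ideal_primeideal[OF assms]
    using P.is_ideal P.I_notcarr P.I_prime by blast
qed

lemma (in cring) radical_primary_mult:
  assumes "primary_ideal R Q" "a \<in> carrier R" "b \<in> carrier R"
    and "a \<notin> radical_ideal R Q" "b \<notin> radical_ideal R Q"
  shows "a \<otimes> b \<notin> radical_ideal R Q"
proof
  assume "a \<otimes> b \<in> radical_ideal R Q"
  then obtain e :: nat where e: "e > 0" "(a \<otimes> b) [^] e \<in> Q"
    unfolding radical_ideal_def by blast
  have "a [^] e \<otimes> b [^] e \<in> Q" using e assms by (simp add: nat_pow_distrib)
  then consider "a [^] e \<in> Q" | "b [^] e \<in> radical_ideal R Q"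
    using assms(1-3) unfolding primary_ideal_def by blast
  then show False
  proof cases
    case 1
    then show False using assms e(1) unfolding radical_ideal_def by blast
  next
    case 2
    then obtain e' :: nat where "e' > 0" "(b [^] e) [^] e' \<in> Q"
      unfolding radical_ideal_def by blast
    then have "e * e' > 0" "b [^] (e * e') \<in> Q" using e assms by (simp_all add: nat_pow_pow)
    then show False using assms unfolding radical_ideal_def by blast
  qed
qed

text \<open>
  A finite intersection \<open>I\<close> of pairwise incomparable primes has those primes as its only minimal
  primary decomposition. Indeed, avoidance shows that each prime \<open>P\<close> is the radical of a component
  \<open>Q\<close> of any other decomposition; multiplying an element of \<open>P\<close> by an element that lies in all the
  other primes but not in \<open>P\<close> gives an element of \<open>I \<subseteq> Q\<close>, so that \<open>P \<subseteq> Q\<close>. The primes being among the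
  components, any further component would be redundant.
\<close>

lemma (in cring) minimal_primary_decomposition_primes:
  assumes fin: "finite D" and prime: "\<And>P. P \<in> D \<Longrightarrow> primeideal P R"
    and antichain: "\<And>P P'. P \<in> D \<Longrightarrow> P' \<in> D \<Longrightarrow> P \<subseteq> P' \<Longrightarrow> P = P'"
  shows "minimal_primary_decomposition R (carrier R \<inter> \<Inter> D) D' \<longleftrightarrow> D' = D"
proof
  have id: "ideal P R" if "P \<in> D" for P
    using prime[OF that] primeideal.axioms(1) by blast
  have one: "\<one> \<notin> P" if "P \<in> D" for P
    using prime[OF that] primeideal.I_notcarr ideal.one_imp_carrier[OF id[OF that]] by metis
  have others: "\<exists>b \<in> carrier R. b \<notin> P \<and> (\<forall>K \<in> D - {P}. b \<in> K)" if "P \<in> D" for P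
  proof (rule ex_in_all_ideals_notin)
    show "finite (D - {P})" using fin by simp
    show "ideal K R" if "K \<in> D - {P}" for K using that id by blast
    show "\<not> K \<subseteq> P" if "K \<in> D - {P}" for K using that antichain \<open>P \<in> D\<close> by blast
    show "\<one> \<notin> P" using one that .
    show "a \<otimes> b \<notin> P" if "a \<in> carrier R" "b \<in> carrier R" "a \<notin> P" "b \<notin> P" for a b
      using that primeideal.I_prime[OF prime[OF \<open>P \<in> D\<close>]] by blast
  qed
  {
    assume "D' = D"
    have "inj_on (radical_ideal R) D"
      using prime radical_ideal_primeideal by (simp add: inj_on_def)
    moreover have "carrier R \<inter> \<Inter> (D - {P}) \<noteq> carrier R \<inter> \<Inter> D" if P: "P \<in> D" for P
    proof -
      obtain b where "b \<in> carrier R" "b \<notin> P" "\<forall>K \<in> D - {P}. b \<in> K"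
        using others[OF P] by blast
      then have "b \<in> carrier R \<inter> \<Inter> (D - {P})" "b \<notin> carrier R \<inter> \<Inter> D" using P by auto
      then show ?thesis by blast
    qed
    ultimately show "minimal_primary_decomposition R (carrier R \<inter> \<Inter> D) D'"
      unfolding minimal_primary_decomposition_def \<open>D' = D\<close>
      using fin primary_ideal_primeideal[OF prime] by (intro conjI ballI) auto
  }
  assume mpd: "minimal_primary_decomposition R (carrier R \<inter> \<Inter> D) D'"
  then have fin': "finite D'" and primary: "\<And>Q. Q \<in> D' \<Longrightarrow> primary_ideal R Q"
    and int: "carrier R \<inter> \<Inter> D' = carrier R \<inter> \<Inter> D"
    and irred: "\<And>Q. Q \<in> D' \<Longrightarrow> carrier R \<inter> \<Inter> (D' - {Q}) \<noteq> carrier R \<inter> \<Inter> D"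
    by (simp_all add: minimal_primary_decomposition_def)
  have id': "ideal Q R" if "Q \<in> D'" for Q
    using primary[OF that] unfolding primary_ideal_def by blast
  have Q_le_P: "\<exists>Q \<in> D'. Q \<subseteq> P" if P: "P \<in> D" for P
  proof (rule ccontr)
    assume neg: "\<not> ?thesis"
    have "\<exists>b \<in> carrier R. b \<notin> P \<and> (\<forall>K \<in> D'. b \<in> K)"
    proof (rule ex_in_all_ideals_notin)
      show "a \<otimes> b \<notin> P" if "a \<in> carrier R" "b \<in> carrier R" "a \<notin> P" "b \<notin> P" for a b
        using that primeideal.I_prime[OF prime[OF P]] by blast
      show "finite D'" by (rule fin')
      show "ideal K R" if "K \<in> D'" for K using id'[OF that] .
      show "\<not> K \<subseteq> P" if "K \<in> D'" for K using neg that by blast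
      show "\<one> \<notin> P" using one[OF P] .
    qed
    then show False using int P by blast
  qed
  have P_le_rad: "\<exists>P \<in> D. P \<subseteq> radical_ideal R Q" if Q: "Q \<in> D'" for Q
  proof (rule ccontr)
    assume neg: "\<not> ?thesis"
    have "\<exists>b \<in> carrier R. b \<notin> radical_ideal R Q \<and> (\<forall>K \<in> D. b \<in> K)"
    proof (rule ex_in_all_ideals_notin)
      show "\<one> \<notin> radical_ideal R Q"
        using primary[OF Q] ideal.one_imp_carrier[OF id'[OF Q]]
        by (auto simp: radical_ideal_def primary_ideal_def)
      show "finite D" by (rule fin)
      show "ideal K R" if "K \<in> D" for K using id[OF that] .
      show "\<not> K \<subseteq> radical_ideal R Q" if "K \<in> D" for K using neg that by blast
      show "a \<otimes> b \<notin> radical_ideal R Q" if "a \<in> carrier R" "b \<in> carrier R"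
        "a \<notin> radical_ideal R Q" "b \<notin> radical_ideal R Q" for a b
        using that by (rule radical_primary_mult[OF primary[OF Q]])
    qed
    then obtain b where b: "b \<in> carrier R" "b \<notin> radical_ideal R Q" "\<forall>K \<in> D. b \<in> K" by blast
    then have "b \<in> Q" using int Q by blast
    then have "b [^] (1::nat) \<in> Q" using b(1) by simp
    then show False using b(1,2) zero_less_one unfolding radical_ideal_def by blast
  qed
  have "P \<in> D'" if P: "P \<in> D" for P
  proof -
    obtain Q where Q: "Q \<in> D'" "Q \<subseteq> P" using Q_le_P P by blast
    obtain P' where P': "P' \<in> D" "P' \<subseteq> radical_ideal R Q" using P_le_rad Q by blast
    have rad_le: "radical_ideal R Q \<subseteq> P"
      using radical_ideal_primeideal[OF prime[OF P]] Q(2) unfolding radical_ideal_def by blast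
    then have rad: "radical_ideal R Q = P" using antichain[OF P'(1) P] P'(2) by blast
    obtain b where b: "b \<in> carrier R" "b \<notin> P" "\<forall>K \<in> D - {P}. b \<in> K" using others P by blast
    have "a \<in> Q" if a: "a \<in> P" for a
    proof -
      have ac: "a \<in> carrier R" using ideal.Icarr[OF id[OF P] a] .
      have "a \<otimes> b \<in> K" if "K \<in> D" for K
        using ideal.I_r_closed[OF id[OF P] a b(1)] ideal.I_l_closed[OF id[OF that] _ ac] b(3) that
        by (cases "K = P") auto
      then have "a \<otimes> b \<in> Q" using int Q(1) ac b(1) by auto
      then show ?thesis using primary[OF Q(1)] ac b(1,2) rad unfolding primary_ideal_def by blast
    qed
    then show ?thesis using Q by (metis subsetI subset_antisym)
  qed
  moreover have "Q \<in> D" if Q: "Q \<in> D'" for Q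
  proof (rule ccontr)
    assume "Q \<notin> D"
    then have "D \<subseteq> D' - {Q}" using calculation by blast
    then have "carrier R \<inter> \<Inter> (D' - {Q}) = carrier R \<inter> \<Inter> D" using int by blast
    then show False using irred Q by blast
  qed
  ultimately show "D' = D" by blast
qed

lemma (in cring) symbolic_power_Inter_primes:
  assumes "finite D" "\<And>P. P \<in> D \<Longrightarrow> primeideal P R"
    and "\<And>P P'. P \<in> D \<Longrightarrow> P' \<in> D \<Longrightarrow> P \<subseteq> P' \<Longrightarrow> P = P'"
  shows "symbolic_power R (carrier R \<inter> \<Inter> D) q = carrier R \<inter> (\<Inter>P \<in> D. P [^]\<^bsub>ideals_set R\<^esub> q)"
  proof -
  have "minimal_primary_decomposition R (carrier R \<inter> \<Inter> D) = (\<lambda>D'. D' = D)"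
    using minimal_primary_decomposition_primes[OF assms] by (intro ext) simp
  then show ?thesis unfolding symbolic_power_def by simp
qed

section \<open>Monomial ideals\<close>

definition monomials :: "nat \<Rightarrow> monom set"
  where "monomials n = {u. Poly_Mapping.keys u \<subseteq> {1..n}}"

definition multiple_closed :: "nat \<Rightarrow> monom set \<Rightarrow> bool"
  where "multiple_closed n M \<longleftrightarrow> M \<subseteq> monomials n \<and> (\<forall>u \<in> M. \<forall>v \<in> monomials n. u + v \<in> M)"

definition monomial_ideal :: "monom set \<Rightarrow> ('k::field_char_0) mpoly set"
  where "monomial_ideal M = {p. Poly_Mapping.keys p \<subseteq> M}"

lemma keys_plus_nat: "Poly_Mapping.keys (u + v) = Poly_Mapping.keys u \<union> Poly_Mapping.keys v"
  for u v :: monom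
  by (auto simp: in_keys_iff lookup_add)

lemma monomials_plus_iff: "u + v \<in> monomials n \<longleftrightarrow> u \<in> monomials n \<and> v \<in> monomials n"
  by (simp add: monomials_def keys_plus_nat)

lemma carrier_eq_monomial_ideal: "carrier (poly_ring n) = monomial_ideal (monomials n)"
  unfolding set_eq_iff carrier_poly_ring monomial_ideal_def monomials_def by blast

lemma poly_ring_simps:
  "p \<oplus>\<^bsub>poly_ring n\<^esub> q = p + q" "p \<otimes>\<^bsub>poly_ring n\<^esub> q = p * q"
  "\<zero>\<^bsub>poly_ring n\<^esub> = 0" "\<one>\<^bsub>poly_ring n\<^esub> = 1"
  by (simp_all add: poly_ring_def)

lemma ring_poly_ring: "ring (poly_ring n :: ('k::field_char_0) mpoly ring)"
  using cring_poly_ring cring.axioms(1) by blast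

lemma single_in_monomial_ideal: "Poly_Mapping.single u c \<in> monomial_ideal M" if "u \<in> M"
  using that by (auto simp: monomial_ideal_def)

lemma single_one_in_monomial_ideal_iff:
  "Poly_Mapping.single u 1 \<in> (monomial_ideal M :: ('k::field_char_0) mpoly set) \<longleftrightarrow> u \<in> M"
  by (simp add: monomial_ideal_def)

lemma monomial_ideal_add:
  "p + q \<in> monomial_ideal M" if "p \<in> monomial_ideal M" "q \<in> monomial_ideal M"
  using that Poly_Mapping.keys_add[of p q] unfolding monomial_ideal_def by blast

lemma monomial_ideal_diff:
  "p - q \<in> monomial_ideal M" if "p \<in> monomial_ideal M" "q \<in> monomial_ideal M"
  using that keys_diff[of p q] unfolding monomial_ideal_def by blast

lemma monomial_ideal_times:
  assumes "multiple_closed n M" "p \<in> monomial_ideal M" "q \<in> carrier (poly_ring n)"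
  shows "p * q \<in> monomial_ideal M"
  unfolding monomial_ideal_def
proof (intro CollectI subsetI)
  fix u
  assume "u \<in> Poly_Mapping.keys (p * q)"
  then obtain a b where "u = a + b" "a \<in> Poly_Mapping.keys p" "b \<in> Poly_Mapping.keys q"
    using Poly_Mapping.keys_mult[of p q] by blast
  then show "u \<in> M"
    using assms unfolding carrier_eq_monomial_ideal monomial_ideal_def multiple_closed_def by blast
qed

lemma ideal_monomial_ideal:
  assumes "multiple_closed n M"
  shows "ideal (monomial_ideal M :: ('k::field_char_0) mpoly set) (poly_ring n)"
proof (rule idealI[OF ring_poly_ring])
  interpret cring "poly_ring n :: 'k mpoly ring" by (rule cring_poly_ring)
  have sub: "monomial_ideal M \<subseteq> carrier (poly_ring n :: 'k mpoly ring)"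
    using assms by (auto simp: carrier_eq_monomial_ideal multiple_closed_def monomial_ideal_def)
  show "subgroup (monomial_ideal M) (add_monoid (poly_ring n :: 'k mpoly ring))"
  proof (rule add.subgroupI)
    fix p :: "'k mpoly"
    assume p: "p \<in> monomial_ideal M"
    have "\<ominus>\<^bsub>poly_ring n\<^esub> p = - p"
    proof (rule minus_equality)
      show "- p \<oplus>\<^bsub>poly_ring n\<^esub> p = \<zero>\<^bsub>poly_ring n\<^esub>" by (simp add: poly_ring_simps)
    qed (use p sub poly_ring_uminus_closed in blast)+
    then show "\<ominus>\<^bsub>poly_ring n\<^esub> p \<in> monomial_ideal M"
      using p by (simp add: monomial_ideal_def)
  next
    have "0 \<in> monomial_ideal M" by (simp add: monomial_ideal_def)
    then show "monomial_ideal M \<noteq> ({} :: 'k mpoly set)" by blast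
  qed (use sub in \<open>simp_all add: poly_ring_simps monomial_ideal_add\<close>)
  fix p q :: "'k mpoly"
  assume "p \<in> monomial_ideal M" "q \<in> carrier (poly_ring n)"
  then have "p * q \<in> monomial_ideal M" using monomial_ideal_times[OF assms] by blast
  then show "p \<otimes>\<^bsub>poly_ring n\<^esub> q \<in> monomial_ideal M" "q \<otimes>\<^bsub>poly_ring n\<^esub> p \<in> monomial_ideal M"
    by (simp_all add: poly_ring_simps mult.commute)
qed

lemma sum_single_lookup:
  "p = (\<Sum>u \<in> Poly_Mapping.keys p. Poly_Mapping.single u (Poly_Mapping.lookup p u))"
  by (rule poly_mapping_eqI)
    (auto simp: lookup_sum lookup_single when_def in_keys_iff)

lemma ideal_contains_if_monomials:
  fixes K :: "('k::field_char_0) mpoly set"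
  assumes "ideal K (poly_ring n)" "Poly_Mapping.keys p \<subseteq> monomials n"
    and in_K: "\<And>u. u \<in> Poly_Mapping.keys p \<Longrightarrow> Poly_Mapping.single u 1 \<in> K"
  shows "p \<in> K"
proof -
  interpret ideal K "poly_ring n" by fact
  have "(\<Sum>u \<in> U. Poly_Mapping.single u (Poly_Mapping.lookup p u)) \<in> K"
    if "U \<subseteq> Poly_Mapping.keys p" for U
    using finite_subset[OF that finite_keys] that
  proof (induction U rule: finite_induct)
    case empty
    then show ?case using additive_subgroup.zero_closed[OF is_additive_subgroup]
      by (simp add: poly_ring_simps)
  next
    case (insert u U)
    have "Poly_Mapping.single 0 (Poly_Mapping.lookup p u) \<in> carrier (poly_ring n)"
      by (simp add: carrier_poly_ring)
    then have "Poly_Mapping.single 0 (Poly_Mapping.lookup p u) * Poly_Mapping.single u 1 \<in> K"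
      using I_l_closed[OF in_K[of u]] insert.prems by (simp add: poly_ring_simps)
    then have "Poly_Mapping.single u (Poly_Mapping.lookup p u) \<in> K"
      by (simp add: mult_single)
    then show ?case using insert additive_subgroup.a_closed[OF is_additive_subgroup]
      by (simp add: poly_ring_simps)
  qed
  then show ?thesis using sum_single_lookup[of p] by (metis order_refl)
qed

lemma genideal_monomials:
  assumes "G \<subseteq> monomials n"
  shows "genideal (poly_ring n) ((\<lambda>u. Poly_Mapping.single u 1) ` G) =
    (monomial_ideal {u \<in> monomials n. \<exists>g \<in> G. \<exists>w. u = g + w} :: ('k::field_char_0) mpoly set)"
    (is "?L = monomial_ideal ?M")
proof
  interpret ring "poly_ring n :: 'k mpoly ring" by (rule ring_poly_ring)
  have "multiple_closed n ?M"
    by (auto simp: multiple_closed_def monomials_plus_iff) (metis add.assoc)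
  moreover have "u \<in> ?M" if "u \<in> G" for u
    using that assms by (auto intro!: bexI[of _ u] exI[of _ 0])
  ultimately show "?L \<subseteq> monomial_ideal ?M"
    by (intro genideal_minimal ideal_monomial_ideal) (auto intro!: single_in_monomial_ideal)
  have G: "(\<lambda>u. Poly_Mapping.single u 1) ` G \<subseteq> carrier (poly_ring n :: 'k mpoly ring)"
    using assms by (auto simp: carrier_poly_ring monomials_def)
  have idl: "ideal ?L (poly_ring n)" using genideal_ideal[OF G] .
  show "monomial_ideal ?M \<subseteq> ?L"
  proof
    fix p :: "'k mpoly"
    assume p: "p \<in> monomial_ideal ?M"
    show "p \<in> ?L"
    proof (rule ideal_contains_if_monomials[OF idl])
      show "Poly_Mapping.keys p \<subseteq> monomials n" using p by (auto simp: monomial_ideal_def)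
      fix u
      assume "u \<in> Poly_Mapping.keys p"
      then obtain g w where u: "u \<in> monomials n" "g \<in> G" "u = g + w"
        using p by (auto simp: monomial_ideal_def)
      have g: "Poly_Mapping.single g 1 \<in> ?L" using genideal_self[OF G] u(2) by auto
      have w: "Poly_Mapping.single w 1 \<in> carrier (poly_ring n :: 'k mpoly ring)"
        using u(1) by (auto simp: u(3) monomials_plus_iff carrier_eq_monomial_ideal
            intro!: single_in_monomial_ideal)
      show "Poly_Mapping.single u 1 \<in> ?L"
        using ideal.I_r_closed[OF idl g w] by (simp add: u(3) poly_ring_simps mult_single)
    qed
  qed
qed

lemma ideal_prod_monomial_ideals:
  assumes M: "multiple_closed n M" and N: "multiple_closed n N"
  shows "ideal_prod (poly_ring n) (monomial_ideal M) (monomial_ideal N) =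
    (monomial_ideal {a + b | a b. a \<in> M \<and> b \<in> N} :: ('k::field_char_0) mpoly set)"
    (is "?L = monomial_ideal ?MN")
proof
  interpret ring "poly_ring n :: 'k mpoly ring" by (rule ring_poly_ring)
  have idl: "ideal ?L (poly_ring n)"
    by (intro ideal_prod_is_ideal ideal_monomial_ideal assms)
  show "?L \<subseteq> monomial_ideal ?MN"
  proof
    fix p
    assume "p \<in> ?L"
    then show "p \<in> monomial_ideal ?MN"
    proof (induction rule: ideal_prod.induct)
      case (prod p q)
      have "Poly_Mapping.keys (p * q) \<subseteq> ?MN"
        using Poly_Mapping.keys_mult[of p q] prod by (auto simp: monomial_ideal_def) blast
      then show ?case by (simp add: monomial_ideal_def poly_ring_simps)
    next
      case (sum p q)
      then show ?case by (simp add: monomial_ideal_add poly_ring_simps)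
    qed
  qed
  show "monomial_ideal ?MN \<subseteq> ?L"
  proof
    fix p :: "'k mpoly"
    assume p: "p \<in> monomial_ideal ?MN"
    show "p \<in> ?L"
    proof (rule ideal_contains_if_monomials[OF idl])
      show "Poly_Mapping.keys p \<subseteq> monomials n"
        using p M N by (force simp: monomial_ideal_def multiple_closed_def monomials_plus_iff)
      fix u
      assume "u \<in> Poly_Mapping.keys p"
      then obtain a b where u: "u = a + b" "a \<in> M" "b \<in> N"
        using p by (auto simp: monomial_ideal_def)
      show "Poly_Mapping.single u 1 \<in> ?L"
        using ideal_prod.prod[OF single_in_monomial_ideal[OF u(2)] single_in_monomial_ideal[OF u(3)],
            of "poly_ring n" "1::'k" "1::'k"]
        by (simp add: u(1) poly_ring_simps mult_single)
    qed
  qed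
qed

text \<open>
  The monomials of a homogeneous element of the ideal have its degree and lie in the ideal, and the
  monomials of the ideal are themselves a generating set.
\<close>

lemma alpha_monomial_ideal:
  assumes "multiple_closed n M"
  shows "alpha n (monomial_ideal M :: ('k::field_char_0) mpoly set) =
    (LEAST d. \<exists>u \<in> M. monom_degree u = d)"
proof -
  interpret ring "poly_ring n :: 'k mpoly ring" by (rule ring_poly_ring)
  have "(\<exists>G. homogeneous_generating_set n (monomial_ideal M :: 'k mpoly set) G \<and>
      (\<exists>g \<in> G. homogeneous_of_degree d g)) \<longleftrightarrow> (\<exists>u \<in> M. monom_degree u = d)" for d
  proof
    assume "\<exists>G. homogeneous_generating_set n (monomial_ideal M :: 'k mpoly set) G \<and>
      (\<exists>g \<in> G. homogeneous_of_degree d g)"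
    then obtain G and g :: "'k mpoly" where G: "G \<subseteq> carrier (poly_ring n)"
      "genideal (poly_ring n) G = monomial_ideal M" "g \<in> G" "homogeneous_of_degree d g"
      unfolding homogeneous_generating_set_def by blast
    then have "g \<in> monomial_ideal M" using genideal_self by blast
    moreover obtain u where "u \<in> Poly_Mapping.keys g"
      using G(4) keys_eq_empty[of g] unfolding homogeneous_of_degree_def by blast
    ultimately show "\<exists>u \<in> M. monom_degree u = d"
      using G(4) by (auto simp: homogeneous_of_degree_def monomial_ideal_def)
  next
    assume "\<exists>u \<in> M. monom_degree u = d"
    then obtain u where u: "u \<in> M" "monom_degree u = d" by blast
    let ?G = "(\<lambda>u. Poly_Mapping.single u 1) ` M :: 'k mpoly set"
    have hom: "homogeneous_of_degree (monom_degree v) (Poly_Mapping.single v 1 :: 'k mpoly)" for v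
      unfolding homogeneous_of_degree_def keys_eq_empty[symmetric] by simp
    have "{u \<in> monomials n. \<exists>g \<in> M. \<exists>w. u = g + w} = M"
      using assms by (auto simp: multiple_closed_def monomials_plus_iff
          intro!: bexI[of _ "_::monom"] exI[of _ "0::monom"])
    then have "homogeneous_generating_set n (monomial_ideal M) ?G"
      using assms genideal_monomials[of M n] hom
      by (auto simp: homogeneous_generating_set_def multiple_closed_def carrier_eq_monomial_ideal
          intro!: single_in_monomial_ideal)
    then show "\<exists>G. homogeneous_generating_set n (monomial_ideal M :: 'k mpoly set) G \<and>
      (\<exists>g \<in> G. homogeneous_of_degree d g)"
      using hom u by blast
  qed
  then show ?thesis unfolding alpha_def by simp
qed

section \<open>Symbolic powers of square-free monomial ideals\<close>

definition weight :: "nat set \<Rightarrow> monom \<Rightarrow> nat"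
  where "weight A u = (\<Sum>h \<in> A. Poly_Mapping.lookup u h)"

text \<open>
  The monomial ideal of this set is \<open>P^q\<close>, where \<open>P\<close> is the prime ideal generated by the
  variables with index in \<open>A\<close>.
\<close>

definition monomials_of_weight_ge :: "nat \<Rightarrow> nat set \<Rightarrow> nat \<Rightarrow> monom set"
  where "monomials_of_weight_ge n A q = {u \<in> monomials n. q \<le> weight A u}"

lemma weight_plus: "weight A (u + v) = weight A u + weight A v"
  by (simp add: weight_def lookup_add sum.distrib)

lemma weight_pos_iff: "finite A \<Longrightarrow> 1 \<le> weight A u \<longleftrightarrow> A \<inter> Poly_Mapping.keys u \<noteq> {}"
  by (auto simp: weight_def Suc_le_eq sum_nonneg_eq_0_iff in_keys_iff simp flip: neq0_conv)

lemma multiple_closed_weight_ge: "multiple_closed n (monomials_of_weight_ge n A q)"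
  by (auto simp: multiple_closed_def monomials_of_weight_ge_def monomials_plus_iff weight_plus)

lemma keys_mapp_if:
  "Poly_Mapping.keys (Poly_Mapping.mapp (\<lambda>u c. if Q u then c else 0) p) =
    {u \<in> Poly_Mapping.keys p. Q u}"
  by (auto simp: in_keys_iff lookup_mapp when_def split: if_splits)

text \<open>
  Primality: modulo the ideal, \<open>p\<close> and \<open>q\<close> may be replaced by their parts \<open>p'\<close> and \<open>q'\<close> that
  avoid the variables in \<open>A\<close>. The product \<open>p' q'\<close> avoids them too, so it lies in the ideal only if
  it vanishes, and polynomials have no zero divisors.
\<close>

lemma primeideal_variables:
  assumes "finite A"
  shows "primeideal (monomial_ideal (monomials_of_weight_ge n A 1) :: ('k::field_char_0) mpoly set)
    (poly_ring n)" (is "primeideal ?P _")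
proof (rule primeidealI[OF ideal_monomial_ideal[OF multiple_closed_weight_ge] cring_poly_ring])
  have "(1 :: 'k mpoly) \<notin> ?P" "(1 :: 'k mpoly) \<in> carrier (poly_ring n)"
    by (auto simp: monomial_ideal_def monomials_of_weight_ge_def weight_def carrier_poly_ring)
  then show "carrier (poly_ring n) \<noteq> ?P" by blast
  fix p q :: "'k mpoly"
  assume p: "p \<in> carrier (poly_ring n)" and q: "q \<in> carrier (poly_ring n)"
    and "p \<otimes>\<^bsub>poly_ring n\<^esub> q \<in> ?P"
  then have pq: "p * q \<in> ?P" by (simp add: poly_ring_simps)
  define r :: "'k mpoly \<Rightarrow> 'k mpoly"
    where "r = Poly_Mapping.mapp (\<lambda>u c. if weight A u = 0 then c else 0)"
  have keys_r: "Poly_Mapping.keys (r p) = {u \<in> Poly_Mapping.keys p. weight A u = 0}" for p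
    unfolding r_def by (rule keys_mapp_if)
  have r_carrier: "r p \<in> carrier (poly_ring n)" if "p \<in> carrier (poly_ring n)" for p
    using that keys_r by (auto simp: carrier_eq_monomial_ideal monomial_ideal_def)
  have diff_r: "p - r p \<in> ?P" if "p \<in> carrier (poly_ring n)" for p
  proof -
    have "Poly_Mapping.keys (p - r p) \<subseteq> {u \<in> Poly_Mapping.keys p. weight A u \<noteq> 0}"
      by (auto simp: in_keys_iff lookup_minus r_def lookup_mapp when_def split: if_splits)
    then show ?thesis
      using that
      by (auto simp: carrier_eq_monomial_ideal monomial_ideal_def monomials_of_weight_ge_def)
  qed
  note times = monomial_ideal_times[OF multiple_closed_weight_ge]
  \<comment> \<open>This difference is \<open>r p * r q\<close>.\<close>
  have "p * q - (q - r q) * p - (p - r p) * r q \<in> ?P"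
    by (intro monomial_ideal_diff times pq diff_r p q r_carrier)
  then have "r p * r q \<in> ?P"
    by (simp add: algebra_simps)
  then have "weight A u \<noteq> 0" if "u \<in> Poly_Mapping.keys (r p * r q)" for u
    using that by (auto simp: monomial_ideal_def monomials_of_weight_ge_def)
  moreover have "weight A u = 0" if "u \<in> Poly_Mapping.keys (r p * r q)" for u
    using that Poly_Mapping.keys_mult[of "r p" "r q"] keys_r by (fastforce simp: weight_plus)
  ultimately have "Poly_Mapping.keys (r p * r q) = {}"
    by blast
  then have "r p = 0 \<or> r q = 0" by simp
  then show "p \<in> ?P \<or> q \<in> ?P"
    using diff_r[OF p] diff_r[OF q] by auto
qed

lemma monomials_of_weight_ge_Suc:
  assumes "A \<subseteq> {1..n}"
  shows "{a + b | a b. a \<in> monomials_of_weight_ge n A q \<and> b \<in> monomials_of_weight_ge n A 1} =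
    monomials_of_weight_ge n A (Suc q)"
proof
  show "{a + b | a b. a \<in> monomials_of_weight_ge n A q \<and> b \<in> monomials_of_weight_ge n A 1} \<subseteq>
    monomials_of_weight_ge n A (Suc q)"
    by (auto simp: monomials_of_weight_ge_def monomials_plus_iff weight_plus)
  have fin: "finite A" using assms finite_subset by blast
  show "monomials_of_weight_ge n A (Suc q) \<subseteq>
    {a + b | a b. a \<in> monomials_of_weight_ge n A q \<and> b \<in> monomials_of_weight_ge n A 1}"
  proof
    fix u
    assume u: "u \<in> monomials_of_weight_ge n A (Suc q)"
    then have "A \<inter> Poly_Mapping.keys u \<noteq> {}"
      using weight_pos_iff[OF fin, of u] by (auto simp: monomials_of_weight_ge_def)
    then obtain h where h: "h \<in> A" "h \<in> Poly_Mapping.keys u" by blast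
    define v where "v = u - Poly_Mapping.single h 1"
    have uv: "u = v + Poly_Mapping.single h 1"
      using h(2) by (intro poly_mapping_eqI)
        (auto simp: v_def lookup_add lookup_minus lookup_single when_def in_keys_iff)
    have w: "weight A (Poly_Mapping.single h 1) = 1"
      using h(1) fin by (simp add: weight_def lookup_single when_def)
    have "v \<in> monomials_of_weight_ge n A q"
      "Poly_Mapping.single h 1 \<in> monomials_of_weight_ge n A 1"
      using u w by (auto simp: monomials_of_weight_ge_def uv monomials_plus_iff weight_plus)
    then show "u \<in> {a + b | a b. a \<in> monomials_of_weight_ge n A q \<and>
        b \<in> monomials_of_weight_ge n A 1}"
      using uv by blast
  qed
qed

lemma power_primeideal_variables:
  assumes "A \<subseteq> {1..n}"
  shows "(monomial_ideal (monomials_of_weight_ge n A 1) :: ('k::field_char_0) mpoly set)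
      [^]\<^bsub>ideals_set (poly_ring n)\<^esub> q = monomial_ideal (monomials_of_weight_ge n A q)"
proof (induction q)
  case 0
  then show ?case
    by (simp add: ideals_set_def nat_pow_def carrier_eq_monomial_ideal monomials_of_weight_ge_def)
next
  case (Suc q)
  have "(monomial_ideal (monomials_of_weight_ge n A 1) :: 'k mpoly set)
      [^]\<^bsub>ideals_set (poly_ring n)\<^esub> Suc q =
    ideal_prod (poly_ring n) (monomial_ideal (monomials_of_weight_ge n A q))
      (monomial_ideal (monomials_of_weight_ge n A 1))"
    using Suc by (simp add: ideals_set_def nat_pow_def)
  then show ?case
    by (simp only: ideal_prod_monomial_ideals[OF multiple_closed_weight_ge multiple_closed_weight_ge]
        monomials_of_weight_ge_Suc[OF assms])
qed

definition transversal :: "nat \<Rightarrow> nat set set \<Rightarrow> nat set \<Rightarrow> bool"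
  where "transversal n F A \<longleftrightarrow> A \<subseteq> {1..n} \<and> (\<forall>U \<in> F. A \<inter> U \<noteq> {})"

definition minimal_transversals :: "nat \<Rightarrow> nat set set \<Rightarrow> nat set set"
  where "minimal_transversals n F =
    {A. transversal n F A \<and> (\<forall>B. transversal n F B \<and> B \<subseteq> A \<longrightarrow> B = A)}"

definition monomials_above :: "nat \<Rightarrow> nat set set \<Rightarrow> monom set"
  where "monomials_above n F = {u \<in> monomials n. \<exists>U \<in> F. U \<subseteq> Poly_Mapping.keys u}"

definition symbolic_monomials :: "nat \<Rightarrow> nat set set \<Rightarrow> nat \<Rightarrow> monom set"
  where "symbolic_monomials n F q = {u \<in> monomials n. \<forall>A. transversal n F A \<longrightarrow> q \<le> weight A u}"

lemma ex_minimal_transversal_subset: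
  assumes "transversal n F A"
  shows "\<exists>B \<in> minimal_transversals n F. B \<subseteq> A"
proof -
  let ?T = "{B. transversal n F B \<and> B \<subseteq> A}"
  have fin: "finite ?T"
    by (rule finite_subset[of _ "Pow {1..n}"]) (auto simp: transversal_def)
  have "A \<in> ?T" using assms by simp
  then obtain B where B: "B \<in> ?T" and min: "\<forall>B' \<in> ?T. B' \<subseteq> B \<longrightarrow> B = B'"
    using finite_has_minimal2[OF fin] by blast
  have "B' = B" if "transversal n F B'" "B' \<subseteq> B" for B'
    using bspec[OF min, of B'] B that by auto
  then show ?thesis using B unfolding minimal_transversals_def by blast
qed

lemma finite_minimal_transversals: "finite (minimal_transversals n F)"
  by (rule finite_subset[of _ "Pow {1..n}"]) (auto simp: minimal_transversals_def transversal_def)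

lemma finite_transversal: "transversal n F A \<Longrightarrow> finite A"
  using finite_subset[of A "{1..n}"] by (simp add: transversal_def)

lemma minimal_transversals_transversal: "A \<in> minimal_transversals n F \<Longrightarrow> transversal n F A"
  by (simp add: minimal_transversals_def)

text \<open>
  If no member of \<open>F\<close> is contained in the support of \<open>u\<close>, then the complement of the support is a
  transversal; the prime of a minimal transversal contained in it does not contain \<open>u\<close>.
\<close>

lemma monomials_above_eq_Inter:
  assumes "F \<subseteq> Pow {1..n}"
  shows "monomials_above n F =
    monomials n \<inter> (\<Inter>A \<in> minimal_transversals n F. monomials_of_weight_ge n A 1)"
proof -
  have fin: "finite A" if "A \<in> minimal_transversals n F" for A
    using finite_transversal[OF minimal_transversals_transversal[OF that]] .
  have "(\<exists>U \<in> F. U \<subseteq> Poly_Mapping.keys u) \<longleftrightarrow>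
      (\<forall>A \<in> minimal_transversals n F. A \<inter> Poly_Mapping.keys u \<noteq> {})" for u :: monom
  proof
    assume "\<exists>U \<in> F. U \<subseteq> Poly_Mapping.keys u"
    then show "\<forall>A \<in> minimal_transversals n F. A \<inter> Poly_Mapping.keys u \<noteq> {}"
      using minimal_transversals_transversal unfolding transversal_def by blast
  next
    assume *: "\<forall>A \<in> minimal_transversals n F. A \<inter> Poly_Mapping.keys u \<noteq> {}"
    show "\<exists>U \<in> F. U \<subseteq> Poly_Mapping.keys u"
    proof (rule ccontr)
      assume "\<not> ?thesis"
      then have "({1..n} - Poly_Mapping.keys u) \<inter> U \<noteq> {}" if "U \<in> F" for U
        using that assms by blast
      then have "transversal n F ({1..n} - Poly_Mapping.keys u)"
        by (simp add: transversal_def)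
      then obtain A where "A \<in> minimal_transversals n F" "A \<subseteq> {1..n} - Poly_Mapping.keys u"
        using ex_minimal_transversal_subset by blast
      then show False using * by blast
    qed
  qed
  then show ?thesis
    using fin weight_pos_iff by (auto simp: monomials_above_def monomials_of_weight_ge_def)
qed

text \<open>
  The weight of a monomial grows with the transversal, so the conditions for the minimal transversals
  imply those for all others.
\<close>

lemma symbolic_monomials_eq_Inter:
  "symbolic_monomials n F q =
    monomials n \<inter> (\<Inter>A \<in> minimal_transversals n F. monomials_of_weight_ge n A q)"
proof -
  have "q \<le> weight A u"
    if "\<forall>A \<in> minimal_transversals n F. q \<le> weight A u" and A: "transversal n F A" for A u
  proof -
    obtain B where B: "B \<in> minimal_transversals n F" "B \<subseteq> A"
      using ex_minimal_transversal_subset[OF A] by blast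
    have "weight B u \<le> weight A u"
      unfolding weight_def using B(2) finite_transversal[OF A] by (intro sum_mono2) auto
    moreover have "q \<le> weight B u" using that(1) B(1) by blast
    ultimately show ?thesis by simp
  qed
  then have "(\<forall>A. transversal n F A \<longrightarrow> q \<le> weight A u) \<longleftrightarrow>
      (\<forall>A \<in> minimal_transversals n F. q \<le> weight A u)" for u
    using minimal_transversals_transversal by metis
  then show ?thesis
    by (auto simp: symbolic_monomials_def monomials_of_weight_ge_def)
qed

lemma symbolic_power_squarefree:
  assumes F: "F \<subseteq> Pow {1..n}"
  shows "symbolic_power (poly_ring n) (monomial_ideal (monomials_above n F)) q =
    (monomial_ideal (symbolic_monomials n F q) :: ('k::field_char_0) mpoly set)"
proof -
  interpret cring "poly_ring n :: 'k mpoly ring" by (rule cring_poly_ring)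
  let ?P = "\<lambda>A. monomial_ideal (monomials_of_weight_ge n A 1) :: 'k mpoly set"
  let ?D = "?P ` minimal_transversals n F"
  have sub: "A \<subseteq> {1..n}" if "A \<in> minimal_transversals n F" for A
    using minimal_transversals_transversal[OF that] by (simp add: transversal_def)
  have fin: "finite A" if "A \<in> minimal_transversals n F" for A
    using finite_transversal[OF minimal_transversals_transversal[OF that]] .
  have inj: "A = B"
    if A: "A \<in> minimal_transversals n F" and B: "B \<in> minimal_transversals n F"
      and le: "?P A \<subseteq> ?P B" for A B
  proof -
    have "A \<subseteq> B"
    proof
      fix a
      assume a: "a \<in> A"
      define x :: monom where "x = Poly_Mapping.single a 1"
      have x: "Poly_Mapping.keys x = {a}" by (simp add: x_def)
      then have "x \<in> monomials_of_weight_ge n A 1"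
        using a sub[OF A] weight_pos_iff[OF fin[OF A], of x]
        by (auto simp: monomials_of_weight_ge_def monomials_def)
      then have "x \<in> monomials_of_weight_ge n B 1"
        using le single_one_in_monomial_ideal_iff by blast
      then show "a \<in> B"
        using x weight_pos_iff[OF fin[OF B], of x] by (auto simp: monomials_of_weight_ge_def)
    qed
    then show ?thesis using A B by (auto simp: minimal_transversals_def)
  qed
  have "monomial_ideal (monomials_above n F) = carrier (poly_ring n) \<inter> \<Inter> ?D"
    unfolding monomials_above_eq_Inter[OF F] carrier_eq_monomial_ideal
    by (auto simp: monomial_ideal_def)
  moreover have "symbolic_power (poly_ring n) (carrier (poly_ring n) \<inter> \<Inter> ?D) q =
    carrier (poly_ring n) \<inter> (\<Inter>P \<in> ?D. P [^]\<^bsub>ideals_set (poly_ring n)\<^esub> q)"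
  proof (rule symbolic_power_Inter_primes)
    show "finite ?D" using finite_minimal_transversals by blast
    show "primeideal P (poly_ring n)" if "P \<in> ?D" for P
      using that primeideal_variables fin by blast
    show "P = P'" if "P \<in> ?D" "P' \<in> ?D" "P \<subseteq> P'" for P P'
      using that inj by blast
  qed
  moreover have "(\<Inter>P \<in> ?D. P [^]\<^bsub>ideals_set (poly_ring n)\<^esub> q) =
    (\<Inter>A \<in> minimal_transversals n F. monomial_ideal (monomials_of_weight_ge n A q))"
    unfolding image_image by (intro INF_cong refl power_primeideal_variables sub)
  ultimately show ?thesis
    unfolding symbolic_monomials_eq_Inter carrier_eq_monomial_ideal
    by (auto simp: monomial_ideal_def)
qed

lemma multiple_closed_symbolic_monomials: "multiple_closed n (symbolic_monomials n F q)"
  by (auto simp: multiple_closed_def symbolic_monomials_def monomials_plus_iff weight_plus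
      trans_le_add1)

section \<open>Waldschmidt constants and fractional transversal weights\<close>

text \<open>
  Fekete's lemma. Division with remainder gives \<open>a q \<le> (q div r) a r + M\<close>, where \<open>M\<close> bounds
  \<open>a\<close> on the remainders; hence \<open>a q / q\<close> is eventually below \<open>a r / r + \<epsilon>\<close> for every \<open>r\<close> and
  converges to the infimum of these quotients.
\<close>

lemma convergent_subadditive_quotient:
  fixes a :: "nat \<Rightarrow> real"
  assumes nonneg: "\<And>q. 0 \<le> a q" and subadd: "\<And>q r. a (q + r) \<le> a q + a r"
  shows "convergent (\<lambda>q. a q / real q)"
proof -
  let ?S = "(\<lambda>q. a q / real q) ` {1..}"
  have bdd: "bdd_below ?S" using nonneg by (intro bdd_belowI2[of _ 0]) simp
  have lower: "Inf ?S \<le> a q / real q" if "q \<ge> 1" for q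
    using that by (intro cInf_lower bdd) auto
  have mult: "a (c * r + d) \<le> real c * a r + a d" for c r d
  proof (induction c)
    case (Suc c)
    have "a (Suc c * r + d) \<le> a r + a (c * r + d)"
      using subadd[of r "c * r + d"] by (simp add: add.assoc)
    then show ?case using Suc by (simp add: algebra_simps)
  qed simp
  have "(\<lambda>q. a q / real q) \<longlonglongrightarrow> Inf ?S"
  proof (rule LIMSEQ_I)
    fix e :: real
    assume e: "0 < e"
    obtain r where r: "r \<ge> 1" "a r / real r < Inf ?S + e / 2"
      using cInf_lessD[of ?S "Inf ?S + e / 2"] e by auto
    define M where "M = Max (a ` {..<r})"
    have M: "a d \<le> M" if "d < r" for d
      using that by (auto simp: M_def)
    obtain N where N: "2 * M / e < real N" using reals_Archimedean2 by blast
    have "norm (a q / real q - Inf ?S) < e" if "q \<ge> max N 1" for q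
    proof -
      have q: "real q > 0" "2 * M / e < real q" using that N by auto
      have "a q \<le> real (q div r) * a r + a (q mod r)"
        using mult[of "q div r" r "q mod r"] by simp
      also have "\<dots> \<le> real q / real r * a r + M"
        using r(1) by (intro add_mono mult_right_mono M nonneg of_nat_div_le_of_nat) auto
      finally have "a q / real q \<le> a r / real r + M / real q"
        using q(1) by (simp add: field_simps)
      moreover have "M / real q < e / 2" using q e by (simp add: field_simps)
      ultimately have "a q / real q < Inf ?S + e" using r(2) by linarith
      then show ?thesis using lower[of q] that by simp
    qed
    then show "\<exists>N. \<forall>q \<ge> N. norm (a q / real q - Inf ?S) < e" by blast
  qed
  then show ?thesis by (rule convergentI)
qed

lemma monom_degree_eq_weight: "monom_degree u = weight {1..n} u" if "u \<in> monomials n"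
  using that unfolding monom_degree_def weight_def monomials_def
  by (intro sum.mono_neutral_left) (auto simp: in_keys_iff)

lemma symbolic_monomials_plus:
  "u + v \<in> symbolic_monomials n F (q + r)"
  if "u \<in> symbolic_monomials n F q" "v \<in> symbolic_monomials n F r"
  using that by (auto simp: symbolic_monomials_def monomials_plus_iff weight_plus add_mono)

text \<open>
  The exponents are \<open>q\<close> times the weights, rounded up; the rounding costs at most one per variable,
  which is negligible as \<open>q\<close> grows.
\<close>

lemma ex_symbolic_monomial_rounding:
  fixes y :: "nat \<Rightarrow> real"
  assumes nonneg: "\<And>h. 0 \<le> y h"
    and cover: "\<And>A. transversal n F A \<Longrightarrow> 1 \<le> (\<Sum>h \<in> A. y h)"
  shows "\<exists>u \<in> symbolic_monomials n F q. real (monom_degree u) \<le> real q * (\<Sum>h = 1..n. y h) + real n"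
proof -
  define c where "c h = nat \<lceil>real q * y h\<rceil>" for h
  have c: "real q * y h \<le> real (c h)" "real (c h) \<le> real q * y h + 1" for h
    using nonneg[of h] by (simp_all add: c_def)
  define u :: monom where "u = (\<Sum>h = 1..n. Poly_Mapping.single h (c h))"
  have lookup: "Poly_Mapping.lookup u h = (if h \<in> {1..n} then c h else 0)" for h
    by (simp add: u_def lookup_sum lookup_single when_def)
  have u: "u \<in> monomials n"
    by (auto simp: monomials_def in_keys_iff lookup split: if_splits)
  have w: "weight A u = (\<Sum>h \<in> A. c h)" if "A \<subseteq> {1..n}" for A
    unfolding weight_def using that by (intro sum.cong) (auto simp: lookup)
  have "q \<le> weight A u" if A: "transversal n F A" for A
  proof -
    have "real q * 1 \<le> real q * (\<Sum>h \<in> A. y h)" using cover[OF A] by (intro mult_left_mono) auto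
    also have "\<dots> \<le> (\<Sum>h \<in> A. real (c h))"
      unfolding sum_distrib_left by (intro sum_mono c)
    finally show ?thesis using A by (simp add: w transversal_def flip: of_nat_sum)
  qed
  moreover have "real (monom_degree u) \<le> real q * (\<Sum>h = 1..n. y h) + real n"
  proof -
    have "real (monom_degree u) = (\<Sum>h = 1..n. real (c h))"
      using u by (simp add: monom_degree_eq_weight w)
    also have "\<dots> \<le> (\<Sum>h = 1..n. real q * y h + 1)" by (intro sum_mono c)
    finally show ?thesis by (simp add: sum.distrib sum_distrib_left)
  qed
  ultimately show ?thesis using u by (auto simp: symbolic_monomials_def)
qed

text \<open>
  The degrees of the rounded monomials, divided by \<open>q\<close>, tend to the total weight. The limit that
  defines the Waldschmidt constant exists because the least degrees are subadditive: the product of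
  a monomial in the \<open>q\<close>-th symbolic power and one in the \<open>r\<close>-th lies in the \<open>(q + r)\<close>-th.
\<close>

lemma waldschmidt_squarefree_le:
  fixes y :: "nat \<Rightarrow> real"
  assumes F: "F \<subseteq> Pow {1..n}" and nonneg: "\<And>h. 0 \<le> y h"
    and cover: "\<And>A. transversal n F A \<Longrightarrow> 1 \<le> (\<Sum>h \<in> A. y h)"
  shows "waldschmidt n (monomial_ideal (monomials_above n F) :: ('k::field_char_0) mpoly set)
    \<le> (\<Sum>h = 1..n. y h)"
proof -
  define a where "a q = (LEAST d. \<exists>u \<in> symbolic_monomials n F q. monom_degree u = d)" for q
  note round = ex_symbolic_monomial_rounding[of y n F, OF nonneg cover]
  have a_le: "a q \<le> monom_degree u" if "u \<in> symbolic_monomials n F q" for q u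
    unfolding a_def using that by (intro Least_le) blast
  have a_ex: "\<exists>u \<in> symbolic_monomials n F q. monom_degree u = a q" for q
  proof -
    have "\<exists>d. \<exists>u \<in> symbolic_monomials n F q. monom_degree u = d" using round[of q] by blast
    then show ?thesis unfolding a_def by (rule LeastI_ex)
  qed
  have alpha: "alpha n (symbolic_power (poly_ring n)
      (monomial_ideal (monomials_above n F) :: 'k mpoly set) q) = a q" for q
    unfolding symbolic_power_squarefree[OF F] a_def
    by (rule alpha_monomial_ideal[OF multiple_closed_symbolic_monomials])
  have "a (q + r) \<le> a q + a r" for q r
  proof -
    obtain u v where uv: "u \<in> symbolic_monomials n F q" "monom_degree u = a q"
      "v \<in> symbolic_monomials n F r" "monom_degree v = a r" using a_ex by meson
    have "u \<in> monomials n" "v \<in> monomials n"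
      using uv by (simp_all add: symbolic_monomials_def)
    then have "monom_degree (u + v) = a q + a r"
      using uv by (simp add: monom_degree_eq_weight[of _ n] monomials_plus_iff weight_plus)
    then show ?thesis using a_le[OF symbolic_monomials_plus[OF uv(1,3)]] by simp
  qed
  then have "convergent (\<lambda>q. real (a q) / real q)"
    by (intro convergent_subadditive_quotient) (simp_all flip: of_nat_add)
  then have lim: "(\<lambda>q. real (a q) / real q) \<longlonglongrightarrow> lim (\<lambda>q. real (a q) / real q)"
    by (simp add: convergent_LIMSEQ_iff)
  have "(\<lambda>q. (\<Sum>h = 1..n. y h) + real n / real q) \<longlonglongrightarrow> (\<Sum>h = 1..n. y h) + 0"
    by (intro tendsto_intros lim_const_over_n)
  moreover have "real (a q) / real q \<le> (\<Sum>h = 1..n. y h) + real n / real q" if "q \<ge> 1" for q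
  proof -
    obtain u where "u \<in> symbolic_monomials n F q"
      "real (monom_degree u) \<le> real q * (\<Sum>h = 1..n. y h) + real n" using round[of q] by blast
    then have "real (a q) \<le> real q * (\<Sum>h = 1..n. y h) + real n" using a_le[of u q] by linarith
    then show ?thesis using that by (simp add: field_simps)
  qed
  ultimately have "lim (\<lambda>q. real (a q) / real q) \<le> (\<Sum>h = 1..n. y h) + 0"
    using lim by (intro LIMSEQ_le[OF lim]) auto
  then show ?thesis by (simp add: waldschmidt_def alpha)
qed

section \<open>Square-free Borel ideals and their transversals\<close>

lemma borel_move_monomials:
  assumes "borel_move u v" "u \<in> monomials n"
  shows "v \<in> monomials n"
proof -
  obtain a b where ab: "a \<in> Poly_Mapping.keys u" "1 \<le> b" "b < a"
    "v = u - Poly_Mapping.single a 1 + Poly_Mapping.single b 1"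
    using assms(1) unfolding borel_move_def by blast
  have "Poly_Mapping.keys (u - Poly_Mapping.single a 1) \<subseteq> Poly_Mapping.keys u"
    by (auto simp: in_keys_iff lookup_minus)
  then show ?thesis using ab assms(2) by (fastforce simp: monomials_def keys_plus_nat)
qed

lemma borel_moves_monomials:
  assumes "borel_move\<^sup>*\<^sup>* u v" "u \<in> monomials n"
  shows "v \<in> monomials n"
  using assms by (induction rule: rtranclp_induct) (blast intro: borel_move_monomials)+

text \<open>
  The factor \<open>w\<close> collects the variables that are not being moved, so that the variables can be
  moved down one after another; intermediate monomials may have repeated variables.
\<close>

lemma borel_moves_decrease:
  assumes "finite J" "\<And>j. j \<in> J \<Longrightarrow> 1 \<le> u j \<and> u j \<le> i j"
  shows "borel_move\<^sup>*\<^sup>* (w + (\<Sum>j \<in> J. Poly_Mapping.single (i j) 1))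
    (w + (\<Sum>j \<in> J. Poly_Mapping.single (u j) 1))"
  using assms
proof (induction J arbitrary: w rule: finite_induct)
  case empty
  then show ?case by simp
next
  case (insert j J)
  let ?v = "\<Sum>j \<in> J. Poly_Mapping.single (u j) (1::nat)"
  have "borel_move\<^sup>*\<^sup>* (w + Poly_Mapping.single (i j) 1 + (\<Sum>j \<in> J. Poly_Mapping.single (i j) 1))
      (w + Poly_Mapping.single (i j) 1 + ?v)"
    using insert by simp
  moreover have "borel_move\<^sup>*\<^sup>* (w + Poly_Mapping.single (i j) 1 + ?v)
      (w + Poly_Mapping.single (u j) 1 + ?v)"
  proof (cases "u j = i j")
    case False
    let ?x = "w + Poly_Mapping.single (i j) 1 + ?v"
    have "1 \<le> u j" "u j < i j" using insert.prems[of j] False by auto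
    moreover have "i j \<in> Poly_Mapping.keys ?x" by (simp add: keys_plus_nat)
    moreover have "w + Poly_Mapping.single (u j) 1 + ?v =
        ?x - Poly_Mapping.single (i j) 1 + Poly_Mapping.single (u j) 1"
    proof -
      have "?x = (w + ?v) + Poly_Mapping.single (i j) 1" by (simp add: ac_simps)
      then show ?thesis by (simp only: add_diff_cancel_right') (simp add: ac_simps)
    qed
    ultimately have "borel_move ?x (w + Poly_Mapping.single (u j) 1 + ?v)"
      unfolding borel_move_def by blast
    then show ?thesis by blast
  qed simp
  ultimately have "borel_move\<^sup>*\<^sup>*
      (w + Poly_Mapping.single (i j) 1 + (\<Sum>j \<in> J. Poly_Mapping.single (i j) 1))
      (w + Poly_Mapping.single (u j) 1 + ?v)"
    by (rule rtranclp_trans)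
  then show ?case using insert.hyps by (simp add: add.assoc)
qed

definition borel_supports :: "monom \<Rightarrow> nat set set"
  where "borel_supports m = Poly_Mapping.keys ` {u. borel_move\<^sup>*\<^sup>* m u \<and> squarefree_monom u}"

lemma borel_supports_subset: "m \<in> monomials n \<Longrightarrow> borel_supports m \<subseteq> Pow {1..n}"
  using borel_moves_monomials unfolding borel_supports_def monomials_def by blast

lemma squarefree_monom_dvd_iff:
  assumes "squarefree_monom g"
  shows "(\<exists>w. u = g + w) \<longleftrightarrow> Poly_Mapping.keys g \<subseteq> Poly_Mapping.keys u"
proof
  assume "\<exists>w. u = g + w"
  then show "Poly_Mapping.keys g \<subseteq> Poly_Mapping.keys u" by (auto simp: keys_plus_nat)
next
  assume sub: "Poly_Mapping.keys g \<subseteq> Poly_Mapping.keys u"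
  have "Poly_Mapping.lookup g h \<le> Poly_Mapping.lookup u h" for h
  proof (cases "h \<in> Poly_Mapping.keys g")
    case True
    then have "h \<in> Poly_Mapping.keys u" using sub by blast
    then have "Poly_Mapping.lookup u h \<noteq> 0" by (simp add: in_keys_iff)
    moreover have "Poly_Mapping.lookup g h \<le> 1" using assms by (simp add: squarefree_monom_def)
    ultimately show ?thesis by simp
  qed (simp add: in_keys_iff)
  then have "u = g + (u - g)" by (intro poly_mapping_eqI) (simp add: lookup_add lookup_minus)
  then show "\<exists>w. u = g + w" by blast
qed

lemma sfBorel_eq_monomial_ideal:
  assumes "m \<in> monomials n"
  shows "sfBorel n m =
    (monomial_ideal (monomials_above n (borel_supports m)) :: ('k::field_char_0) mpoly set)"
proof -
  let ?G = "{u. borel_move\<^sup>*\<^sup>* m u \<and> squarefree_monom u}"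
  have "?G \<subseteq> monomials n" using borel_moves_monomials assms by blast
  moreover have "{Poly_Mapping.single u (1::'k) | u. borel_move\<^sup>*\<^sup>* m u \<and> squarefree_monom u} =
      (\<lambda>u. Poly_Mapping.single u 1) ` ?G" by blast
  moreover have "{u \<in> monomials n. \<exists>g \<in> ?G. \<exists>w. u = g + w} = monomials_above n (borel_supports m)"
    using squarefree_monom_dvd_iff by (auto simp: monomials_above_def borel_supports_def)
  ultimately show ?thesis by (simp add: sfBorel_def genideal_monomials)
qed

text \<open>Greedy choice: the \<open>j\<close>-th set has an element outside the \<open>j - 1\<close> elements already chosen.\<close>

lemma ex_distinct_representatives:
  fixes B :: "nat \<Rightarrow> 'a set"
  assumes "\<And>j. j \<in> {1..s} \<Longrightarrow> finite (B j) \<and> j \<le> card (B j)"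
  shows "\<exists>u. inj_on u {1..s} \<and> (\<forall>j \<in> {1..s}. u j \<in> B j)"
  using assms
proof (induction s)
  case (Suc s)
  then obtain u where u: "inj_on u {1..s}" "\<forall>j \<in> {1..s}. u j \<in> B j" by auto
  have "card (u ` {1..s}) < card (B (Suc s))"
    using card_image[OF u(1)] Suc.prems[of "Suc s"] by simp
  then obtain b where b: "b \<in> B (Suc s)" "b \<notin> u ` {1..s}"
    by (metis card_mono finite_atLeastAtMost finite_imageI not_less subsetI)
  define u' where "u' = u(Suc s := b)"
  have "u' j = u j" if "j \<in> {1..s}" for j
    using that by (auto simp: u'_def)
  then have "u' ` {1..s} = u ` {1..s}" "inj_on u' {1..s}"
    using u(1) image_cong[of "{1..s}" "{1..s}" u' u] inj_on_cong[of "{1..s}" u' u] by simp_all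
  moreover have "{1..Suc s} = insert (Suc s) {1..s}" by auto
  moreover have "u' (Suc s) = b" by (simp add: u'_def)
  ultimately have "inj_on u' {1..Suc s}" using b(2) by (simp add: inj_on_insert)
  moreover have "u' j \<in> B j" if "j \<in> {1..Suc s}" for j
    using u(2) b(1) that by (cases "j = Suc s") (auto simp: u'_def)
  ultimately show ?case by blast
qed simp

text \<open>
  The square-free monomials reachable from \<open>x\<^bsub>i 1\<^esub> \<cdots> x\<^bsub>i s\<^esub>\<close> include all products of distinct
  variables \<open>x\<^bsub>u 1\<^esub> \<cdots> x\<^bsub>u s\<^esub>\<close> with \<open>u j \<le> i j\<close>. A set that leaves at least \<open>j\<close> elements of each
  \<open>{1..i j}\<close> uncovered therefore misses the support of such a product.
\<close>

lemma transversal_borel_supports_large: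
  assumes "transversal n (borel_supports (\<Sum>j \<in> {1..s}. Poly_Mapping.single (i j) 1)) A"
  shows "\<exists>j \<in> {1..s}. i j + 1 \<le> j + card (A \<inter> {1..i j})"
proof (rule ccontr)
  let ?m = "\<Sum>j \<in> {1..s}. Poly_Mapping.single (i j) (1::nat)"
  assume neg: "\<not> ?thesis"
  have "finite ({1..i j} - A) \<and> j \<le> card ({1..i j} - A)" if "j \<in> {1..s}" for j
  proof -
    have "card ({1..i j} - A) = i j - card (A \<inter> {1..i j})"
      by (simp add: card_Diff_subset_Int Int_commute)
    then show ?thesis using neg that by force
  qed
  then obtain u where inj: "inj_on u {1..s}" and u: "\<forall>j \<in> {1..s}. u j \<in> {1..i j} - A"
    using ex_distinct_representatives[of s "\<lambda>j. {1..i j} - A"] by blast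
  define v where "v = (\<Sum>j \<in> {1..s}. Poly_Mapping.single (u j) (1::nat))"
  have "borel_move\<^sup>*\<^sup>* ?m v"
    using borel_moves_decrease[of "{1..s}" u i 0] u by (simp add: v_def)
  moreover have lookup: "Poly_Mapping.lookup v h = card {j \<in> {1..s}. u j = h}" for h
  proof -
    have "Poly_Mapping.lookup v h = (\<Sum>j \<in> {1..s}. if u j = h then 1 else 0)"
      by (simp add: v_def lookup_sum lookup_single when_def del: One_nat_def)
    also have "\<dots> = (\<Sum>j \<in> {j \<in> {1..s}. u j = h}. 1)"
      by (rule sum.inter_filter[symmetric]) simp
    finally show ?thesis by simp
  qed
  have "squarefree_monom v"
    unfolding squarefree_monom_def
  proof
    fix h
    have "card {j \<in> {1..s}. u j = h} \<le> Suc 0"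
    proof -
      have "j = j'" if "j \<in> {j \<in> {1..s}. u j = h}" "j' \<in> {j \<in> {1..s}. u j = h}" for j j'
        using inj_onD[OF inj, of j j'] that by simp
      moreover have "finite {j \<in> {1..s}. u j = h}" by simp
      ultimately show ?thesis by (subst card_le_Suc0_iff_eq) blast+
    qed
    then show "Poly_Mapping.lookup v h \<le> 1" using lookup by simp
  qed
  ultimately have "Poly_Mapping.keys v \<in> borel_supports ?m"
    unfolding borel_supports_def by blast
  moreover have "Poly_Mapping.keys v \<subseteq> u ` {1..s}"
    by (auto simp: in_keys_iff lookup card_eq_0_iff)
  ultimately show False using assms u unfolding transversal_def by blast
qed

section \<open>Weights for the blocks of consecutive variables\<close>

lemma strict_mono_on_nat_gap:
  fixes i :: "nat \<Rightarrow> nat"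
  assumes "strict_mono_on {1..s} i" "1 \<le> a" "a \<le> b" "b \<le> s"
  shows "i a + (b - a) \<le> i b"
  using assms(3,4)
proof (induction b rule: dec_induct)
  case (step b)
  then have "i b < i (Suc b)" using assms(1,2) by (intro strict_mono_onD[OF assms(1)]) auto
  then show ?case using step by simp
qed simp

lemma T_tuple_hd: "hd (T_tuple i t) = t"
  by (subst T_tuple.simps) (simp add: Let_def)

lemma T_tuple_Max:
  assumes "J = {j. 1 \<le> j \<and> j < t \<and> i j < i (j + 1) - 1}"
  shows "J = {} \<Longrightarrow> T_tuple i t = [t]"
    and "J \<noteq> {} \<Longrightarrow> T_tuple i t = t # T_tuple i (Max J)"
    and "J \<noteq> {} \<Longrightarrow> Max J \<in> J"
    and "j \<in> J \<Longrightarrow> j \<le> Max J"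
proof -
  have fin: "finite J" unfolding assms by (rule finite_subset[of _ "{..<t}"]) auto
  show "J = {} \<Longrightarrow> T_tuple i t = [t]" and "J \<noteq> {} \<Longrightarrow> T_tuple i t = t # T_tuple i (Max J)"
    by (subst T_tuple.simps; simp add: Let_def assms)+
  show "J \<noteq> {} \<Longrightarrow> Max J \<in> J" "j \<in> J \<Longrightarrow> j \<le> Max J" using fin by simp_all
qed

lemma T_tuple_bounds: "e \<in> set (T_tuple i t) \<Longrightarrow> 1 \<le> t \<Longrightarrow> 1 \<le> e \<and> e \<le> t"
proof (induction t rule: less_induct)
  case (less t)
  define J where "J = {j. 1 \<le> j \<and> j < t \<and> i j < i (j + 1) - 1}"
  note J = T_tuple_Max[OF J_def]
  show ?case
  proof (cases "J = {}")
    case True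
    then show ?thesis using less.prems J(1) by simp
  next
    case False
    then have "1 \<le> Max J" "Max J < t" using J(3) by (auto simp: J_def)
    then show ?thesis using less.prems less.IH[of "Max J"] J(2)[OF False] by auto
  qed
qed

lemma T_tuple_sorted: "1 \<le> t \<Longrightarrow> sorted_wrt (>) (T_tuple i t)"
proof (induction t rule: less_induct)
  case (less t)
  define J where "J = {j. 1 \<le> j \<and> j < t \<and> i j < i (j + 1) - 1}"
  note J = T_tuple_Max[OF J_def]
  show ?case
  proof (cases "J = {}")
    case True
    then show ?thesis using J(1) by simp
  next
    case False
    then have "1 \<le> Max J" "Max J < t" using J(3) by (auto simp: J_def)
    then show ?thesis using less.IH[of "Max J"] J(2)[OF False] T_tuple_bounds[of _ i "Max J"] by force
  qed
qed

text \<open>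
  The entries of the tuple are the right ends of the maximal blocks of indices on which \<open>i\<close> increases
  in steps of one; \<open>e\<close> is the right end of the block of \<open>j\<close>.
\<close>

lemma T_tuple_block:
  assumes "strict_mono_on {1..t} i" "1 \<le> j" "j \<le> t"
  shows "\<exists>e \<in> set (T_tuple i t). j \<le> e \<and> i e = i j + (e - j)"
  using assms
proof (induction t rule: less_induct)
  case (less t)
  define J where "J = {j. 1 \<le> j \<and> j < t \<and> i j < i (j + 1) - 1}"
  note J = T_tuple_Max[OF J_def]
  show ?case
  proof (cases "J \<noteq> {} \<and> j \<le> Max J")
    case True
    then have "Max J < t" using J(3) by (auto simp: J_def)
    moreover from this have "strict_mono_on {1..Max J} i"
      by (intro monotone_on_subset[OF less.prems(1)]) auto
    ultimately show ?thesis using less.IH[of "Max J"] less.prems(2) True J(2) by auto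
  next
    case False
    have "i t = i j + (t - j)"
    proof -
      have "i b = i j + (b - j)" if "j \<le> b" "b \<le> t" for b
        using that
      proof (induction b rule: dec_induct)
        case (step b)
        then have "b \<notin> J" using False J(4)[of b] by auto
        then have "i (b + 1) \<le> i b + 1" using step less.prems(2) by (simp add: J_def)
        moreover have "i b < i (b + 1)"
          using step less.prems(2) by (intro strict_mono_onD[OF less.prems(1)]) auto
        ultimately show ?case using step by simp
      qed simp
      from this[of t] show ?thesis using less.prems(3) by simp
    qed
    moreover have "t \<in> set (T_tuple i t)" by (subst T_tuple.simps) (simp add: Let_def)
    ultimately show ?thesis using less.prems(3) by auto
  qed
qed

lemma sum_interval:
  fixes z :: real
  assumes "a \<le> b" "b \<le> n"
  shows "(\<Sum>h = 1..n. if a < h \<and> h \<le> b then z else 0) = (real b - real a) * z"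
proof -
  have "(\<Sum>h = 1..n. if a < h \<and> h \<le> b then z else 0) = (\<Sum>h \<in> {h \<in> {1..n}. a < h \<and> h \<le> b}. z)"
    by (rule sum.inter_filter[symmetric]) simp
  also have "{h \<in> {1..n}. a < h \<and> h \<le> b} = {a<..b}" using assms by auto
  finally show ?thesis using assms by (simp add: of_nat_diff)
qed

text \<open>
  A step function. In the application \<open>c j = i (t j)\<close> is the largest variable index of the \<open>j\<close>-th
  block (blocks are counted from the right) and \<open>d j = c j - t j + 1\<close>; both decrease with \<open>j\<close>, so
  the weight \<open>1 / d j\<close> on \<open>{c (j + 1)<..c j}\<close> is smaller the further right it lies. The last weight
  \<open>1 / d l\<close> extends beyond \<open>c l\<close> up to \<open>N\<close>.
\<close>

definition block_weights ::
    "(nat \<Rightarrow> nat) \<Rightarrow> (nat \<Rightarrow> real) \<Rightarrow> nat \<Rightarrow> nat \<Rightarrow> nat \<Rightarrow> nat \<Rightarrow> real"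
  where "block_weights c d l k N h =
    (if 0 < h \<and> h \<le> c k then 1 / d k else 0)
    + (\<Sum>j = l..<k. if c (j + 1) < h \<and> h \<le> c j then 1 / d j else 0)
    + (if c l < h \<and> h \<le> N then 1 / d l else 0)"

lemma block_weights_nonneg:
  assumes "\<And>j. j \<in> {l..k} \<Longrightarrow> 0 < d j" "l \<le> k"
  shows "0 \<le> block_weights c d l k N h"
proof -
  have "0 \<le> 1 / d j" if "j \<in> {l..k}" for j using assms(1)[OF that] by simp
  then show ?thesis
    using assms(2) unfolding block_weights_def by (intro add_nonneg_nonneg sum_nonneg) auto
qed

lemma sum_block_weights:
  assumes "\<And>j. j \<in> {l..<k} \<Longrightarrow> c (j + 1) \<le> c j" "\<And>j. j \<in> {l..k} \<Longrightarrow> c j \<le> n"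
    and "l \<le> k" "c l \<le> N" "N \<le> n"
  shows "(\<Sum>h = 1..n. block_weights c d l k N h) =
    (real N - real (c l)) / d l + (\<Sum>j = l..<k. (real (c j) - real (c (j + 1))) / d j)
    + real (c k) / d k"
proof -
  have "(\<Sum>h = 1..n. \<Sum>j = l..<k. if c (j + 1) < h \<and> h \<le> c j then 1 / d j else 0) =
      (\<Sum>j = l..<k. (real (c j) - real (c (j + 1))) * (1 / d j))"
    using assms by (subst sum.swap) (intro sum.cong refl sum_interval; simp)
  then show ?thesis
    using assms sum_interval[of 0 "c k" n "1 / d k"] sum_interval[of "c l" N n "1 / d l"]
    by (simp add: block_weights_def sum.distrib)
qed

text \<open>
  Either \<open>h\<close> lies in the first interval, or the last \<open>j\<close> with \<open>h \<le> c j\<close> satisfies \<open>p \<le> j\<close>; in both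
  cases the weight at \<open>h\<close> is at least the reciprocal of some \<open>d j \<le> d p\<close>.
\<close>

lemma block_weights_ge:
  assumes d: "\<And>j. j \<in> {l..k} \<Longrightarrow> 0 < d j"
    and mono: "\<And>a b. a \<le> b \<Longrightarrow> b \<le> k \<Longrightarrow> d b \<le> d a"
    and p: "l \<le> p" "p \<le> k" and h: "1 \<le> h" "h \<le> c p"
  shows "1 / d p \<le> block_weights c d l k N h"
proof -
  have le: "1 / d p \<le> 1 / d j" if "p \<le> j" "j \<le> k" for j
    using mono[OF that] d[of j] p that by (intro divide_left_mono) auto
  have pos: "0 \<le> 1 / d j" if "j \<in> {l..k}" for j using d[OF that] by simp
  have sum_pos: "0 \<le> (\<Sum>j = l..<k. if c (j + 1) < h \<and> h \<le> c j then 1 / d j else 0)"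
    using pos by (intro sum_nonneg) auto
  have last_pos: "0 \<le> (if c l < h \<and> h \<le> N then 1 / d l else 0)" using pos[of l] p by simp
  show ?thesis
  proof (cases "h \<le> c k")
    case True
    then show ?thesis using h le[of k] sum_pos last_pos p unfolding block_weights_def by simp
  next
    case False
    have "\<exists>j. p \<le> j \<and> j < k \<and> h \<le> c j \<and> \<not> h \<le> c (j + 1)"
    proof (rule ccontr)
      assume neg: "\<not> ?thesis"
      have "h \<le> c k" using p(2) by (induction k rule: dec_induct) (use h(2) neg in auto)
      then show False using False by simp
    qed
    then obtain j where j: "p \<le> j" "j < k" "c (j + 1) < h" "h \<le> c j" by auto
    have "1 / d j = (if c (j + 1) < h \<and> h \<le> c j then 1 / d j else 0)" using j by simp
    also have "\<dots> \<le> (\<Sum>j = l..<k. if c (j + 1) < h \<and> h \<le> c j then 1 / d j else 0)"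
      using j p pos by (intro member_le_sum) auto
    finally show ?thesis using le[of j] j last_pos False unfolding block_weights_def by simp
  qed
qed

text \<open>
  The parameter \<open>l\<close> says where the tail of small weights is cut off, at the price of the first summand.
\<close>

lemma waldschmidt_sfBorel_le:
  fixes i t :: "nat \<Rightarrow> nat"
  assumes "1 \<le> s" and mono: "strict_mono_on {1..s} i" and img: "i ` {1..s} \<subseteq> {1..n}"
    and T: "T_tuple i s = map t [0..<k + 1]" and "l \<le> k"
  shows "waldschmidt n
      (sfBorel n (\<Sum>j \<in> {1..s}. Poly_Mapping.single (i j) 1) :: ('k::field_char_0) mpoly set) \<le>
    (real (t 0) - real (t l)) / (real (i (t l)) - real (t l) + 1)
    + (\<Sum>j = l..<k. (real (i (t j)) - real (i (t (j + 1)))) / (real (i (t j)) - real (t j) + 1))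
    + real (i (t k)) / (real (i (t k)) - real (t k) + 1)"
proof -
  define m :: monom where "m = (\<Sum>j \<in> {1..s}. Poly_Mapping.single (i j) 1)"
  define c where "c p = i (t p)" for p
  define d where "d p = real (c p) - real (t p) + 1" for p
  \<comment> \<open>With this choice \<open>N + 1 - j \<ge> d l\<close> for all \<open>j \<le> s\<close>: even if \<open>j - 1\<close> elements of \<open>{1..N}\<close>
    are missing from a set, its remaining elements there carry a total weight of at least 1.\<close>
  define N where "N = c l + (s - t l)"
  let ?y = "block_weights c d l k N"
  have t0: "t 0 = s"
    using T_tuple_hd[of i s] unfolding T by (simp add: upt_conv_Cons del: upt_Suc)
  have t_bounds: "1 \<le> t p \<and> t p \<le> s" if "p \<le> k" for p
  proof -
    have "t p \<in> set (T_tuple i s)" using that unfolding T by (simp del: upt_Suc)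
    then show ?thesis using T_tuple_bounds \<open>1 \<le> s\<close> by blast
  qed
  have t_antimono: "t b \<le> t a" if "a \<le> b" "b \<le> k" for a b
  proof (cases "a = b")
    case False
    have "\<forall>x y. x < y \<longrightarrow> y < k + 1 \<longrightarrow> t y < t x"
      using T_tuple_sorted[OF \<open>1 \<le> s\<close>, of i] unfolding T
      by (simp add: sorted_wrt_map sorted_wrt_iff_nth_less del: upt_Suc)
    then have "t b < t a" using that False by simp
    then show ?thesis by simp
  qed simp
  have gap: "c b + (t a - t b) \<le> c a" if "a \<le> b" "b \<le> k" for a b
    unfolding c_def
    using that t_antimono[OF that] t_bounds[of a] t_bounds[of b]
    by (intro strict_mono_on_nat_gap[OF mono]) auto
  have c_antimono: "c b \<le> c a" if "a \<le> b" "b \<le> k" for a b using gap[OF that] by simp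
  have d_antimono: "d b \<le> d a" if "a \<le> b" "b \<le> k" for a b
    using gap[OF that] t_antimono[OF that] by (simp add: d_def)
  have t_le_c: "t p \<le> c p" if "p \<le> k" for p
    using strict_mono_on_nat_gap[OF mono, of 1 "t p"] t_bounds[OF that] img \<open>1 \<le> s\<close>
    by (fastforce simp: c_def)
  then have d_pos: "0 < d p" if "p \<le> k" for p using that[THEN t_le_c] by (simp add: d_def)
  have c_le: "c p \<le> n" if "p \<le> k" for p
  proof -
    have "t p \<in> {1..s}" using t_bounds[OF that] by simp
    then have "i (t p) \<in> {1..n}" using img by blast
    then show ?thesis by (simp add: c_def)
  qed
  have N_le: "N \<le> n" using gap[of 0 l] c_le[of 0] t0 \<open>l \<le> k\<close> by (simp add: N_def)
  have nonneg: "0 \<le> ?y h" for h using d_pos \<open>l \<le> k\<close> by (intro block_weights_nonneg) auto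
  have y_ge: "1 / d p \<le> ?y h" if "l \<le> p" "p \<le> k" "1 \<le> h" "h \<le> c p" for p h
    using that d_pos d_antimono by (intro block_weights_ge) auto
  have y_ge_l: "1 / d l \<le> ?y h" if "1 \<le> h" "h \<le> N" for h
  proof (cases "h \<le> c l")
    case True
    then show ?thesis using y_ge that \<open>l \<le> k\<close> by simp
  next
    case False
    have "0 \<le> (\<Sum>j = l..<k. if c (j + 1) < h \<and> h \<le> c j then 1 / d j else 0)"
      using d_pos by (intro sum_nonneg) (auto simp: less_imp_le)
    moreover have "0 \<le> (if 0 < h \<and> h \<le> c k then 1 / d k else 0)" using d_pos[of k] by simp
    ultimately show ?thesis using False that unfolding block_weights_def by simp
  qed
  have cover_count: "1 \<le> (\<Sum>h \<in> A. ?y h)"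
    if "finite A" "p \<le> k" "B \<subseteq> A" "d p \<le> real (card B)" "\<And>h. h \<in> B \<Longrightarrow> 1 / d p \<le> ?y h"
    for A B p
  proof -
    have "1 = d p * (1 / d p)" using d_pos[OF \<open>p \<le> k\<close>] by simp
    also have "\<dots> \<le> real (card B) * (1 / d p)"
      using that d_pos[OF \<open>p \<le> k\<close>] by (intro mult_right_mono) auto
    also have "\<dots> = (\<Sum>h \<in> B. 1 / d p)" by simp
    also have "\<dots> \<le> (\<Sum>h \<in> B. ?y h)" using that by (intro sum_mono) auto
    also have "\<dots> \<le> (\<Sum>h \<in> A. ?y h)" using that nonneg by (intro sum_mono2) auto
    finally show ?thesis .
  qed
  have m: "m \<in> monomials n"
    using img keys_sum[of "\<lambda>j. Poly_Mapping.single (i j) (1::nat)" "{1..s}"]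
    by (fastforce simp: m_def monomials_def)
  have cover: "1 \<le> (\<Sum>h \<in> A. ?y h)" if A: "transversal n (borel_supports m) A" for A
  proof -
    have fin: "finite A" using A by (rule finite_transversal)
    obtain j where j: "j \<in> {1..s}" "i j + 1 \<le> j + card (A \<inter> {1..i j})"
      using transversal_borel_supports_large[OF A[unfolded m_def]] by blast
    obtain e where e: "e \<in> set (T_tuple i s)" "j \<le> e" "i e = i j + (e - j)"
      using T_tuple_block[OF mono, of j] j(1) by auto
    then obtain p where "p < k + 1" "e = t p"
      unfolding T by (auto simp del: upt_Suc)
    then have p: "p \<le> k" "j \<le> t p" "c p = i j + (t p - j)"
      using e by (simp_all add: c_def)
    show ?thesis
    proof (cases "l \<le> p")
      case True
      show ?thesis
      proof (rule cover_count[of A p "A \<inter> {1..i j}"])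
        show "d p \<le> real (card (A \<inter> {1..i j}))" using j(2) p by (simp add: d_def)
      qed (use fin p True y_ge in auto)
    next
      case False
      \<comment> \<open>Weight is lost only beyond \<open>N\<close>. At most \<open>j - 1\<close> elements of \<open>{1..?b}\<close> are missing from \<open>A\<close>,
        and \<open>?b + 1 - j\<close> is at least \<open>d l\<close>, either because \<open>d\<close> decreases or by the choice of \<open>N\<close>.\<close>
      let ?b = "min (i j) N"
      have "card (A \<inter> {1..i j}) \<le> card (A \<inter> {1..?b}) + card {?b<..i j}"
        using card_mono[of "A \<inter> {1..?b} \<union> {?b<..i j}" "A \<inter> {1..i j}"]
          card_Un_le[of "A \<inter> {1..?b}" "{?b<..i j}"] by fastforce
      then have "?b + 1 \<le> j + card (A \<inter> {1..?b})" using j(2) by simp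
      moreover have "d l + real j \<le> real ?b + 1"
      proof -
        have "d l \<le> d p" using False p(1) \<open>l \<le> k\<close> by (intro d_antimono) auto
        then have "d l + real j \<le> real (i j) + 1" using p by (simp add: d_def)
        moreover have "d l + real j \<le> real N + 1"
          using j(1) t_bounds[OF \<open>l \<le> k\<close>] by (simp add: d_def N_def)
        ultimately show ?thesis by (simp add: min_def)
      qed
      ultimately have "d l \<le> real (card (A \<inter> {1..?b}))" by linarith
      then show ?thesis
        using cover_count[of A l "A \<inter> {1..?b}"] fin \<open>l \<le> k\<close> y_ge_l by auto
    qed
  qed
  have "waldschmidt n (sfBorel n m :: 'k mpoly set) \<le> (\<Sum>h = 1..n. ?y h)"
    unfolding sfBorel_eq_monomial_ideal[OF m]
    by (rule waldschmidt_squarefree_le[OF borel_supports_subset[OF m] nonneg cover])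
  also have "\<dots> = (real N - real (c l)) / d l
      + (\<Sum>j = l..<k. (real (c j) - real (c (j + 1))) / d j) + real (c k) / d k"
    using c_antimono c_le N_le \<open>l \<le> k\<close> by (intro sum_block_weights) (auto simp: N_def)
  also have "real N - real (c l) = real (t 0) - real (t l)"
    using t0 t_bounds[OF \<open>l \<le> k\<close>] by (simp add: N_def)
  finally show ?thesis unfolding m_def c_def d_def .
qed

theorem theorem3p3:
  fixes n s k l :: nat and i t :: "nat \<Rightarrow> nat" and m :: monom
    and I :: "('k::field_char_0) mpoly set"
  assumes "s \<ge> 1"
    and "strict_mono_on {1..s} i"
    and "i ` {1..s} \<subseteq> {1..n}"
    and "m = (\<Sum>j\<in>{1..s}. Poly_Mapping.single (i j) 1)"
    and "T_tuple i s = map t [0..<k + 1]"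
    and "I = sfBorel n m"
    and "l = (LEAST p. p \<le> k \<and> (p < k \<longrightarrow> i (t (p + 1)) < t 0) \<and> t 0 \<le> i (t p))"
  shows "waldschmidt n I \<le>
    (real (t 0) - real (t l)) / (real (i (t l)) - real (t l) + 1)
    + (\<Sum>j = l..<k. (real (i (t j)) - real (i (t (j + 1)))) / (real (i (t j)) - real (t j) + 1))
    + real (i (t k)) / (real (i (t k)) - real (t k) + 1)"
proof -
  have t0: "t 0 = s"
    using T_tuple_hd[of i s] unfolding assms(5) by (simp add: upt_conv_Cons del: upt_Suc)
  have "t 0 \<le> i (t 0)"
    using strict_mono_on_nat_gap[OF assms(2), of 1 s] assms(1,3) t0 by fastforce
  \<comment> \<open>The set that defines \<open>l\<close> is not empty: it contains the last \<open>p\<close> with \<open>t 0 \<le> i (t p)\<close>.\<close>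
  let ?S = "{p. p \<le> k \<and> t 0 \<le> i (t p)}"
  have fin: "finite ?S" by simp
  have "0 \<in> ?S" using \<open>t 0 \<le> i (t 0)\<close> by simp
  then obtain p where p: "p \<in> ?S" "\<And>q. q \<in> ?S \<Longrightarrow> q \<le> p"
    using Max_in[OF fin] Max_ge[OF fin] by blast
  have "p + 1 \<notin> ?S" using p(2)[of "p + 1"] by linarith
  then have "p \<le> k \<and> (p < k \<longrightarrow> i (t (p + 1)) < t 0) \<and> t 0 \<le> i (t p)"
    using p(1) by auto
  then have "l \<le> k" unfolding assms(7) by (rule LeastI2) blast
  then show ?thesis
    unfolding assms(4,6) by (rule waldschmidt_sfBorel_le[OF assms(1-3,5)])
qed

end
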